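(* Let $\omega=\omega(n)$ be any function with $\omega(n)\to\infty$ as $n\to\infty$, let $\gamma\in(0,1)$ be a constant, and set $z=z(n,\omega):=\omega\sqrt{n}$. If the edge-probability $p=p(n)$ satisfies $0<p\le\gamma$, then there is an interval of length at most $L=L(n,p,\gamma)$ that contains $\chi(G_{n,p})$ with high probability, where $$L:=\frac{Czp}{\log(zp/\log n)}\quad\text{if } zp\gg\log n,\qquad L:=\frac{C\log n}{\log(\log n/(zp))}\quad\text{if } zp\ll\log n,$$ and $C=C(\gamma)>0$ is a constant (depending only on $\gamma$).
   Context: $G_{n,p}$ denotes the binomial random graph on vertex set $[n]$ in which each pair of vertices is an edge independently with probability $p$; $\chi$ denotes the chromatic number. For positive functions, $a\ll b$ means $a/b\to0$ as $n\to\infty$. "With high probability" means with probability tending to $1$ as $n\to\infty$. "There is an interval of length at most $L(n)$ that contains $\chi(G_{n,p})$ with high probability" means there exist intervals $I_n$ of length at most $L(n)$ with $\Pr(\chi(G_{n,p})\in I_n)\to1$. *)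

theory Defs
  imports "HOL-Probability.Probability"
begin

text \<open>Vertex set [n] is rendered as {0..<n}; a graph on it is a set of edges,
each edge a 2-element set {u,v} with u \<noteq> v.\<close>

definition all_pairs :: "nat \<Rightarrow> nat set set" where
  "all_pairs n = {{u, v} | u v. u < n \<and> v < n \<and> u \<noteq> v}"

definition gnp :: "nat \<Rightarrow> real \<Rightarrow> nat set set pmf" where
  "gnp n p = map_pmf (\<lambda>f. {e \<in> all_pairs n. f e})
                     (Pi_pmf (all_pairs n) False (\<lambda>_. bernoulli_pmf p))"

definition proper_colouring :: "nat \<Rightarrow> nat set set \<Rightarrow> nat \<Rightarrow> (nat \<Rightarrow> nat) \<Rightarrow> bool" where
  "proper_colouring n E k c \<longleftrightarrow>
     (\<forall>v<n. c v < k) \<and> (\<forall>u v. {u, v} \<in> E \<and> u \<noteq> v \<longrightarrow> c u \<noteq> c v)"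

definition chromatic_number :: "nat \<Rightarrow> nat set set \<Rightarrow> nat" where
  "chromatic_number n E = (LEAST k. \<exists>c. proper_colouring n E k c)"

end

theory Submission
  imports Defs
begin

text \<open>
  Let \<open>k\<close> be the least number with \<open>P(\<chi> \<le> k) \<ge> 4 / \<omega>\<^sup>2\<close>, and let \<open>Y\<close> be the least number of
  vertices whose deletion leaves a \<open>k\<close>-colourable graph. Changing the edges at one vertex changes
  \<open>Y\<close> by at most 1, so \<open>Var Y \<le> n\<close>; as \<open>Y = 0\<close> with probability at least \<open>4 / \<omega>\<^sup>2\<close>, Chebyshev's
  inequality used twice gives \<open>Y \<le> z\<close> with high probability. It remains to colour every set of at
  most \<open>z\<close> vertices with few extra colours. By Chernoff and a union bound all small sets \<open>U\<close> span few
  edges. If \<open>z p \<lless> ln n\<close>, this bounds the degeneracy. If \<open>z p \<ggreater> ln n\<close>, every large \<open>U\<close> has a vertex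
  of degree at most \<open>(1 + \<epsilon>) p |U|\<close> in \<open>U\<close>, so choosing such vertices greedily yields independent
  sets of order \<open>ln (z p / ln n) / p\<close>, each of which becomes a colour class; the small rest is
  coloured by degeneracy. When the bound on the interval length drops below a constant, \<open>p\<close> is so small that
  the graph has no edges.
\<close>

subsection \<open>Colouring by degeneracy and by greedy independent sets\<close>

definition colourable :: "'a set set \<Rightarrow> 'a set \<Rightarrow> nat \<Rightarrow> bool" where
  "colourable E W k \<longleftrightarrow>
     (\<exists>c. (\<forall>v\<in>W. c v < k) \<and> (\<forall>u\<in>W. \<forall>v\<in>W. {u, v} \<in> E \<and> u \<noteq> v \<longrightarrow> c u \<noteq> c v))"

definition nbrs :: "'a set set \<Rightarrow> 'a set \<Rightarrow> 'a \<Rightarrow> 'a set" where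
  "nbrs E U v = {w \<in> U. w \<noteq> v \<and> {v, w} \<in> E}"

definition induced_edges :: "'a set set \<Rightarrow> 'a set \<Rightarrow> 'a set set" where
  "induced_edges E U = {e \<in> E. e \<subseteq> U}"

lemma colourableI:
  assumes "\<And>v. v \<in> W \<Longrightarrow> c v < k"
    and "\<And>u v. u \<in> W \<Longrightarrow> v \<in> W \<Longrightarrow> {u, v} \<in> E \<Longrightarrow> u \<noteq> v \<Longrightarrow> c u \<noteq> c v"
  shows "colourable E W k"
  unfolding colourable_def using assms by (intro exI[of _ c]) simp

lemma colourableE:
  assumes "colourable E W k"
  obtains c where "\<forall>v\<in>W. c v < k"
    and "\<forall>u\<in>W. \<forall>v\<in>W. {u, v} \<in> E \<longrightarrow> u \<noteq> v \<longrightarrow> c u \<noteq> c v"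
proof -
  obtain c where "(\<forall>v\<in>W. c v < k) \<and> (\<forall>u\<in>W. \<forall>v\<in>W. {u, v} \<in> E \<and> u \<noteq> v \<longrightarrow> c u \<noteq> c v)"
    using assms unfolding colourable_def ..
  then show thesis
    by (intro that[of c]) simp_all
qed

lemma colourable_empty: "colourable E {} k"
  by (simp add: colourable_def)

text \<open>Independent sets are phrased as 1-colourable sets from here on, so that
  \<open>colourable_Un\<close> can add one as a single new colour class.\<close>

lemma colourable_1_iff: "colourable E W 1 \<longleftrightarrow> (\<forall>u\<in>W. \<forall>v\<in>W. u \<noteq> v \<longrightarrow> {u, v} \<notin> E)"
  unfolding colourable_def by fastforce

lemma colourable_mono: "colourable E W k \<Longrightarrow> k \<le> l \<Longrightarrow> colourable E W l"
  unfolding colourable_def by (meson order_less_le_trans)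

text \<open>The palettes are kept disjoint by shifting the colours on \<open>S\<close> by
  \<open>k\<close>; a vertex lying in both sets keeps its colour from \<open>W\<close>.\<close>

lemma colourable_Un:
  assumes "colourable E W k" "colourable E S l"
  shows "colourable E (W \<union> S) (k + l)"
proof -
  obtain c where "\<forall>v\<in>W. c v < k"
      "\<forall>u\<in>W. \<forall>v\<in>W. {u, v} \<in> E \<longrightarrow> u \<noteq> v \<longrightarrow> c u \<noteq> c v"
    using assms(1) by (rule colourableE)
  note c = this[rule_format]
  obtain d where "\<forall>v\<in>S. d v < l"
      "\<forall>u\<in>S. \<forall>v\<in>S. {u, v} \<in> E \<longrightarrow> u \<noteq> v \<longrightarrow> d u \<noteq> d v"
    using assms(2) by (rule colourableE)
  note d = this[rule_format]
  let ?c = "\<lambda>v. if v \<in> W then c v else k + d v"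
  show ?thesis
  proof (rule colourableI)
    show "?c v < k + l" if "v \<in> W \<union> S" for v
      using that c(1)[of v] d(1)[of v] by auto
    show "?c u \<noteq> ?c v" if "u \<in> W \<union> S" "v \<in> W \<union> S" "{u, v} \<in> E" "u \<noteq> v" for u v
      using that c(2)[of u v] d(2)[of u v] c(1)[of u] c(1)[of v]
      by (cases "u \<in> W"; cases "v \<in> W") auto
  qed
qed

text \<open>If every vertex exceeded the average degree of the graph induced on \<open>U\<close>,
  double counting the incidences of vertices and edges would give too many edges.\<close>

lemma exists_low_degree_vertex:
  assumes "finite U" "U \<noteq> {}" "\<And>e. e \<in> E \<Longrightarrow> card e = 2"
  shows "\<exists>v\<in>U. card U * card (nbrs E U v) \<le> 2 * card (induced_edges E U)"
proof (rule ccontr)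
  let ?F = "induced_edges E U"
  assume "\<not> ?thesis"
  then have gt: "\<And>v. v \<in> U \<Longrightarrow> 2 * card ?F < card U * card (nbrs E U v)"
    by (auto simp: not_le)
  have finF: "finite ?F"
    by (rule finite_subset[of _ "Pow U"]) (use assms(1) in \<open>auto simp: induced_edges_def\<close>)
  have le: "card (nbrs E U v) \<le> card {e \<in> ?F. v \<in> e}" if "v \<in> U" for v
  proof (rule card_inj_on_le[where f = "\<lambda>w. {v, w}"])
    show "inj_on (\<lambda>w. {v, w}) (nbrs E U v)"
      by (auto simp: inj_on_def nbrs_def doubleton_eq_iff)
    show "finite {e \<in> ?F. v \<in> e}" using finF by simp
  qed (use that in \<open>auto simp: nbrs_def induced_edges_def\<close>)
  have two: "card {v \<in> U. v \<in> e} = 2" if "e \<in> ?F" for e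
  proof -
    have "{v \<in> U. v \<in> e} = e" using that by (auto simp: induced_edges_def)
    then show ?thesis using that assms(3) by (simp add: induced_edges_def)
  qed
  have "(\<Sum>v\<in>U. card (nbrs E U v)) \<le> (\<Sum>v\<in>U. card {e \<in> ?F. v \<in> e})"
    by (intro sum_mono le)
  also have "\<dots> = 2 * card ?F"
    using sum_multicount[of U ?F "\<lambda>v e. v \<in> e" 2] assms(1) finF two by simp
  finally have "card U * (\<Sum>v\<in>U. card (nbrs E U v)) \<le> card U * (2 * card ?F)"
    by simp
  moreover have "(\<Sum>v\<in>U. 2 * card ?F) < (\<Sum>v\<in>U. card U * card (nbrs E U v))"
    by (intro sum_strict_mono gt assms)
  ultimately show False
    by (simp add: sum_distrib_left)
qed

text \<open>Induction on \<open>card S\<close>: set aside a vertex with fewer than \<open>d\<close>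
  neighbours and colour the rest; its neighbours then block fewer than \<open>d\<close>
  colours.\<close>

lemma colourable_if_degenerate:
  assumes "finite S"
    and "\<And>U. U \<subseteq> S \<Longrightarrow> U \<noteq> {} \<Longrightarrow> \<exists>v\<in>U. card (nbrs E U v) < d"
  shows "colourable E S d"
  using assms
proof (induction "card S" arbitrary: S)
  case 0
  then show ?case by (simp add: colourable_empty)
next
  case (Suc m)
  then have "S \<noteq> {}" by auto
  then obtain v where v: "v \<in> S" "card (nbrs E S v) < d"
    using Suc.prems(2) by blast
  have "colourable E (S - {v}) d"
    using Suc v(1) by (intro Suc.hyps) auto
  then obtain c where "\<forall>x\<in>S - {v}. c x < d"
      "\<forall>x\<in>S - {v}. \<forall>y\<in>S - {v}. {x, y} \<in> E \<longrightarrow> x \<noteq> y \<longrightarrow> c x \<noteq> c y"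
    by (rule colourableE)
  note c = this[rule_format]
  have fin: "finite (nbrs E S v)" using Suc.prems(1) by (simp add: nbrs_def)
  have "card (c ` nbrs E S v) < d"
    using v(2) card_image_le[OF fin, of c] by linarith
  then have "\<not> {..<d} \<subseteq> c ` nbrs E S v"
    using card_mono[of "c ` nbrs E S v" "{..<d}"] fin by auto
  then obtain k where k: "k < d" "k \<notin> c ` nbrs E S v" by auto
  let ?c = "c(v := k)"
  show ?case
  proof (rule colourableI)
    show "?c x < d" if "x \<in> S" for x
      using that c(1)[of x] k(1) by auto
    show "?c x \<noteq> ?c y" if xy: "x \<in> S" "y \<in> S" "{x, y} \<in> E" "x \<noteq> y" for x y
    proof -
      have "y \<in> nbrs E S v" if "x = v"
        using that xy by (auto simp: nbrs_def)
      moreover have "x \<in> nbrs E S v" if "y = v"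
        using that xy by (auto simp: nbrs_def insert_commute)
      ultimately show ?thesis
        using c(2)[of x y] k(2) xy by (cases "x = v"; cases "y = v") auto
    qed
  qed
qed

text \<open>Choosing \<open>v\<close> and discarding it together with its neighbours keeps at least
  a fraction \<open>1 - q\<close> of the set, so the size stays at least \<open>u0\<close> for
  \<open>j\<close> rounds. The \<open>+ 1\<close> in the degree condition accounts for
  \<open>v\<close> itself. What is left at the end is nonempty and supplies vertex number
  \<open>j + 1\<close>.\<close>

lemma exists_independent_subset:
  fixes q u0 :: real
  assumes "finite W" "0 < u0" "0 \<le> q" "q < 1"
    and "\<And>U. U \<subseteq> W \<Longrightarrow> u0 \<le> card U \<Longrightarrow> \<exists>v\<in>U. card (nbrs E U v) + 1 \<le> q * card U"
    and "u0 \<le> card W * (1 - q) ^ j"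
  shows "\<exists>I\<subseteq>W. j + 1 \<le> card I \<and> colourable E I 1"
  using assms(1,5,6)
proof (induction j arbitrary: W)
  case 0
  then have "W \<noteq> {}" using assms(2) by auto
  then obtain v where v: "v \<in> W" by blast
  show ?case
    using v by (intro exI[of _ "{v}"]) (auto simp: colourable_1_iff simp del: One_nat_def)
next
  case (Suc j)
  have "(1 - q) ^ Suc j \<le> 1" using assms by (intro power_le_one) auto
  then have "card W * (1 - q) ^ Suc j \<le> card W" by (simp add: mult_left_le del: power_Suc)
  then have "u0 \<le> card W" using Suc.prems(3) by linarith
  then obtain v where v: "v \<in> W" "card (nbrs E W v) + 1 \<le> q * card W"
    using Suc.prems(2) by blast
  let ?W = "W - insert v (nbrs E W v)"
  have sub: "insert v (nbrs E W v) \<subseteq> W" using v(1) by (auto simp: nbrs_def)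
  have "card (insert v (nbrs E W v)) = card (nbrs E W v) + 1"
    using Suc.prems(1) by (subst card_insert_disjoint) (auto simp: nbrs_def)
  then have "real (card ?W) = card W - (card (nbrs E W v) + 1)"
    using card_Diff_subset[OF finite_subset[OF sub Suc.prems(1)] sub]
      card_mono[OF Suc.prems(1) sub] by simp
  then have "card W * (1 - q) \<le> card ?W" using v(2) by (simp add: algebra_simps)
  then have "card W * (1 - q) * (1 - q) ^ j \<le> card ?W * (1 - q) ^ j"
    using assms(4) by (intro mult_right_mono) auto
  then have "u0 \<le> card ?W * (1 - q) ^ j" using Suc.prems(3) by (simp add: mult.assoc)
  then obtain I where I: "I \<subseteq> ?W" "j + 1 \<le> card I" "colourable E I 1"
    using Suc.IH[of ?W] Suc.prems(1) Suc.prems(2)[OF subset_trans[OF _ Diff_subset]] by auto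
  have finI: "finite I" "v \<notin> I"
    using I(1) Suc.prems(1) finite_subset[of I W] by auto
  have "{v, w} \<notin> E" if "w \<in> I" for w
    using I(1) that by (auto simp: nbrs_def)
  then have "colourable E (insert v I) 1"
    using I(3) unfolding colourable_1_iff by (metis insert_iff insert_commute)
  moreover have "Suc j + 1 \<le> card (insert v I)" "insert v I \<subseteq> W" using I finI v(1) by auto
  ultimately show ?case by blast
qed

text \<open>Each independent set removed has at least \<open>\<kappa>\<close> vertices, so its one
  colour is paid for by a drop of at least 1 in \<open>card S / \<kappa>\<close>. Once fewer than
  \<open>u1\<close> vertices remain, \<open>d\<close> colours finish the job.\<close>

lemma colourable_by_peeling:
  fixes \<kappa> u1 :: real
  assumes "finite S" "0 < \<kappa>"
    and "\<And>U. U \<subseteq> S \<Longrightarrow> u1 \<le> card U \<Longrightarrow> \<exists>I\<subseteq>U. \<kappa> \<le> card I \<and> colourable E I 1"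
    and "\<And>U. U \<subseteq> S \<Longrightarrow> card U < u1 \<Longrightarrow> colourable E U d"
  shows "\<exists>k. colourable E S k \<and> real k \<le> d + card S / \<kappa>"
  using assms(1,3,4)
proof (induction "card S" arbitrary: S rule: less_induct)
  case less
  show ?case
  proof (cases "card S < u1")
    case True
    then show ?thesis using less.prems(3)[of S] assms(2) by (intro exI[of _ d]) auto
  next
    case False
    then obtain I where I: "I \<subseteq> S" "\<kappa> \<le> card I" "colourable E I 1"
      using less.prems(2)[of S] by auto
    then have "I \<noteq> {}" using assms(2) by auto
    have fin: "finite I" using I(1) less.prems(1) finite_subset by blast
    have card: "real (card (S - I)) = real (card S) - real (card I)"
      using I(1) fin card_mono[OF less.prems(1) I(1)] by (simp add: card_Diff_subset)
    have "card (S - I) < card S"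
      using I(1) \<open>I \<noteq> {}\<close> less.prems(1) by (intro psubset_card_mono) auto
    then obtain k where k: "colourable E (S - I) k" "real k \<le> d + card (S - I) / \<kappa>"
      using less.hyps[of "S - I"] less.prems(1) less.prems(2,3)[OF subset_trans[OF _ Diff_subset[of S I]]]
      by auto
    have "colourable E ((S - I) \<union> I) (k + 1)"
      using k(1) I(3) by (rule colourable_Un)
    moreover have "(S - I) \<union> I = S" using I(1) by auto
    moreover have "real (k + 1) \<le> d + card S / \<kappa>"
    proof -
      have "1 \<le> card I / \<kappa>" using I(2) assms(2) by simp
      then show ?thesis using k(2) unfolding card by (simp add: diff_divide_distrib)
    qed
    ultimately show ?thesis by (intro exI[of _ "k + 1"]) simp
  qed
qed

subsection \<open>Variance of Lipschitz functions on product spaces\<close>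

lemma expectation_pair_pmf_finite:
  fixes f :: "'a \<times> 'b \<Rightarrow> real"
  assumes "finite (set_pmf M)" "finite (set_pmf N)"
  shows "measure_pmf.expectation (pair_pmf M N) f =
         measure_pmf.expectation M (\<lambda>x. measure_pmf.expectation N (\<lambda>y. f (x, y)))"
proof -
  have "measure_pmf.expectation (pair_pmf M N) f =
        (\<Sum>z\<in>set_pmf M \<times> set_pmf N. pmf (pair_pmf M N) z *\<^sub>R f z)"
    using assms by (intro integral_measure_pmf) auto
  also have "\<dots> = (\<Sum>x\<in>set_pmf M. \<Sum>y\<in>set_pmf N. pmf M x * (pmf N y * f (x, y)))"
    by (auto simp: sum.cartesian_product pmf_pair mult.assoc intro!: sum.cong)
  also have "\<dots> = (\<Sum>x\<in>set_pmf M. pmf M x *\<^sub>R (\<Sum>y\<in>set_pmf N. pmf N y *\<^sub>R f (x, y)))"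
    by (simp add: sum_distrib_left)
  also have "(\<lambda>x. \<Sum>y\<in>set_pmf N. pmf N y *\<^sub>R f (x, y)) =
             (\<lambda>x. measure_pmf.expectation N (\<lambda>y. f (x, y)))"
    by (intro ext integral_measure_pmf[symmetric]) (use assms in auto)
  also have "(\<Sum>x\<in>set_pmf M. pmf M x *\<^sub>R measure_pmf.expectation N (\<lambda>y. f (x, y))) =
             measure_pmf.expectation M (\<lambda>x. measure_pmf.expectation N (\<lambda>y. f (x, y)))"
    by (intro integral_measure_pmf[symmetric]) (use assms in auto)
  finally show ?thesis .
qed

lemma finite_set_Pi_pmf:
  assumes "finite A" "\<And>x. x \<in> A \<Longrightarrow> finite (set_pmf (p x))"
  shows "finite (set_pmf (Pi_pmf A dflt p))"
  using assms by (simp add: set_Pi_pmf finite_PiE_dflt)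

text \<open>The bias-variance decomposition. With an arbitrary constant \<open>c\<close> it bounds a
  variance from above; with \<open>c\<close> the mean over a larger product it gives the law of
  total variance.\<close>

lemma expectation_square_shift:
  fixes f :: "'a \<Rightarrow> real"
  assumes "finite (set_pmf M)"
  shows "measure_pmf.expectation M (\<lambda>x. (f x - c)\<^sup>2) =
         measure_pmf.variance M f + (measure_pmf.expectation M f - c)\<^sup>2"
proof -
  note int = integrable_measure_pmf_finite[OF assms]
  let ?m = "measure_pmf.expectation M f"
  have "measure_pmf.expectation M (\<lambda>x. (f x - c)\<^sup>2) =
        measure_pmf.expectation M (\<lambda>x. (f x - ?m)\<^sup>2 + (2 * (?m - c) * (f x - ?m) + (?m - c)\<^sup>2))"
    by (intro arg_cong[of _ _ "measure_pmf.expectation M"] ext) algebra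
  also have "\<dots> = measure_pmf.variance M f + (2 * (?m - c) * (?m - ?m) + (?m - c)\<^sup>2)"
    by (simp add: int)
  finally show ?thesis by simp
qed

text \<open>The Efron--Stein inequality in its crudest form: conditioning on all blocks but the last
  splits the variance, and the conditional mean inherits the Lipschitz property.\<close>

lemma variance_Pi_pmf_le:
  fixes f :: "('a \<Rightarrow> 'b) \<Rightarrow> real" and B :: "nat \<Rightarrow> 'a set"
  assumes "\<And>i. i < n \<Longrightarrow> finite (B i)"
    and "\<And>i j. i < n \<Longrightarrow> j < n \<Longrightarrow> i \<noteq> j \<Longrightarrow> B i \<inter> B j = {}"
    and p: "\<And>x. finite (set_pmf (p x))"
    and "\<And>i g h. i < n \<Longrightarrow> (\<And>x. x \<notin> B i \<Longrightarrow> g x = h x) \<Longrightarrow> \<bar>f g - f h\<bar> \<le> 1"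
  shows "measure_pmf.variance (Pi_pmf (\<Union>i<n. B i) dflt p) f \<le> n"
  using assms(1,2,4)
proof (induction n arbitrary: f)
  case 0
  then show ?case by simp
next
  case (Suc n)
  define A where "A = (\<Union>i<n. B i)"
  define M where "M = Pi_pmf A dflt p"
  define N where "N = Pi_pmf (B n) dflt p"
  define cmb where "cmb g h x = (if x \<in> A then g x else h x)" for g h :: "'a \<Rightarrow> 'b" and x
  define F where "F g = measure_pmf.expectation N (\<lambda>h. f (cmb g h))" for g
  define m where "m = measure_pmf.expectation M F"
  have finA: "finite A" using Suc.prems(1) by (auto simp: A_def)
  have finM: "finite (set_pmf M)" and finN: "finite (set_pmf N)"
    unfolding M_def N_def using finA Suc.prems(1) p by (auto intro!: finite_set_Pi_pmf)
  note int = integrable_measure_pmf_finite[OF finM] integrable_measure_pmf_finite[OF finN]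
  have "B i \<inter> B n = {}" if "i < n" for i
    using that by (intro Suc.prems(2)) auto
  then have disj: "A \<inter> B n = {}"
    unfolding A_def by blast
  have eq: "Pi_pmf (\<Union>i<Suc n. B i) dflt p = map_pmf (\<lambda>(g, h). cmb g h) (pair_pmf M N)"
  proof -
    have "(\<Union>i<Suc n. B i) = A \<union> B n" by (auto simp: A_def lessThan_Suc)
    then show ?thesis
      using Pi_pmf_union[OF finA Suc.prems(1)[OF lessI] disj, of dflt p]
      by (simp add: M_def N_def cmb_def[abs_def] case_prod_unfold)
  qed
  have expect: "measure_pmf.expectation (Pi_pmf (\<Union>i<Suc n. B i) dflt p) \<phi> =
        measure_pmf.expectation M (\<lambda>g. measure_pmf.expectation N (\<lambda>h. \<phi> (cmb g h)))"
    for \<phi> :: "_ \<Rightarrow> real"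
    by (simp add: eq expectation_pair_pmf_finite[OF finM finN] case_prod_unfold)
  have mean: "measure_pmf.expectation (Pi_pmf (\<Union>i<Suc n. B i) dflt p) f = m"
    by (simp add: expect m_def F_def[abs_def])
  have inner: "measure_pmf.variance N (\<lambda>h. f (cmb g h)) \<le> 1" for g
  proof -
    \<comment> \<open>A variance is at most the mean squared distance from any constant; the
      constant used is the value at a fixed outcome \<open>h0\<close> of the last block.\<close>
    obtain h0 :: "'a \<Rightarrow> 'b" where "h0 \<in> set_pmf N"
      using set_pmf_not_empty by fast
    have "measure_pmf.variance N (\<lambda>h. f (cmb g h)) \<le>
          measure_pmf.expectation N (\<lambda>h. (f (cmb g h) - f (cmb g h0))\<^sup>2)"
      by (subst expectation_square_shift[OF finN]) simp
    also have "\<dots> \<le> measure_pmf.expectation N (\<lambda>h. 1)"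
    proof (intro integral_mono_AE int AE_pmfI)
      fix h assume "h \<in> set_pmf N"
      \<comment> \<open>Outside \<open>B n\<close> both outcomes equal \<open>dflt\<close>, so the
        combined functions can differ only in block \<open>n\<close>.\<close>
      then have "cmb g h x = cmb g h0 x" if "x \<notin> B n" for x
        using that \<open>h0 \<in> set_pmf N\<close> set_Pi_pmf_subset[OF Suc.prems(1)[OF lessI], of dflt p]
        unfolding N_def cmb_def by (auto simp: subset_iff)
      then have "\<bar>f (cmb g h) - f (cmb g h0)\<bar> \<le> 1"
        by (intro Suc.prems(3)[of n]) auto
      then show "(f (cmb g h) - f (cmb g h0))\<^sup>2 \<le> 1"
        by (simp add: abs_square_le_1)
    qed
    finally show ?thesis by simp
  qed
  have lip: "\<bar>F g - F g'\<bar> \<le> 1" if "i < n" "\<And>x. x \<notin> B i \<Longrightarrow> g x = g' x" for i g g'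
  proof -
    have "F g - F g' = measure_pmf.expectation N (\<lambda>h. f (cmb g h) - f (cmb g' h))"
      by (simp add: F_def int)
    also have "\<bar>\<dots>\<bar> \<le> measure_pmf.expectation N (\<lambda>h. \<bar>f (cmb g h) - f (cmb g' h)\<bar>)"
      by (rule integral_abs_bound)
    also have "\<dots> \<le> measure_pmf.expectation N (\<lambda>h. 1)"
    proof (intro integral_mono int)
      show "\<bar>f (cmb g h) - f (cmb g' h)\<bar> \<le> 1" for h
        using that by (intro Suc.prems(3)[of i]) (auto simp: cmb_def)
    qed
    finally show ?thesis by simp
  qed
  have "measure_pmf.variance (Pi_pmf (\<Union>i<Suc n. B i) dflt p) f =
        measure_pmf.expectation M (\<lambda>g. measure_pmf.expectation N (\<lambda>h. (f (cmb g h) - m)\<^sup>2))"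
    unfolding mean by (rule expect)
  \<comment> \<open>Total variance: the mean of the conditional variances, each at most 1, plus the
    variance of \<open>F\<close>, which the induction hypothesis bounds.\<close>
  also have "\<dots> = measure_pmf.expectation M
      (\<lambda>g. measure_pmf.variance N (\<lambda>h. f (cmb g h)) + (F g - m)\<^sup>2)"
    unfolding F_def
    by (intro arg_cong[of _ _ "measure_pmf.expectation M"] ext expectation_square_shift[OF finN])
  also have "\<dots> \<le> measure_pmf.expectation M (\<lambda>g. 1 + (F g - m)\<^sup>2)"
    by (intro integral_mono int add_right_mono inner)
  also have "\<dots> = 1 + measure_pmf.variance M F"
    by (simp add: int m_def)
  also have "measure_pmf.variance M F \<le> n"
    unfolding M_def A_def using Suc.prems(1,2) lip by (intro Suc.IH) auto
  finally show ?case by simp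
qed

subsection \<open>The binomial random graph\<close>

lemma all_pairs_eq: "all_pairs n = {e. e \<subseteq> {..<n} \<and> card e = 2}"
  by (auto simp: all_pairs_def card_2_iff)

text \<open>Vertex exposure: each pair goes into the block of its larger endpoint. There are only
  \<open>n\<close> blocks, and all pairs in block \<open>i\<close> contain \<open>i\<close>, so a
  change inside a block is a change at one vertex.\<close>

lemma all_pairs_eq_Union: "all_pairs n = (\<Union>i<n. {{u, i} | u. u < i})"
proof (intro equalityI subsetI)
  fix e assume "e \<in> all_pairs n"
  then obtain u v where uv: "e = {u, v}" "u < n" "v < n" "u \<noteq> v"
    by (auto simp: all_pairs_def)
  show "e \<in> (\<Union>i<n. {{u, i} | u. u < i})"
  proof (cases "u < v")
    case True
    then show ?thesis using uv by blast
  next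
    case False
    then have "v < u" "e = {v, u}" using uv by auto
    then show ?thesis using uv by blast
  qed
qed (auto simp: all_pairs_def, metis order.strict_trans nat_neq_iff)

lemma finite_all_pairs: "finite (all_pairs n)"
  by (rule finite_subset[of _ "Pow {..<n}"]) (auto simp: all_pairs_eq)

lemma set_pmf_gnp_subset: "E \<in> set_pmf (gnp n p) \<Longrightarrow> E \<subseteq> all_pairs n"
  by (auto simp: gnp_def)

lemma finite_set_pmf_gnp: "finite (set_pmf (gnp n p))"
  by (rule finite_subset[of _ "Pow (all_pairs n)"])
     (auto dest: set_pmf_gnp_subset simp: finite_all_pairs)

section \<open>Edge counts of induced subgraphs\<close>

lemma expectation_power_induced_edges:
  fixes p x :: real
  assumes "0 \<le> p" "p \<le> 1" "0 \<le> x" "U \<subseteq> {..<n}"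
  shows "measure_pmf.expectation (gnp n p) (\<lambda>E. x ^ card (induced_edges E U)) =
         (1 + p * (x - 1)) ^ (card U choose 2)"
proof -
  have fin: "finite U" using assms(4) finite_subset by blast
  \<comment> \<open>\<open>\<phi> e\<close> is the factor that the pair \<open>e\<close> contributes
    to the power of \<open>x\<close>. The pairs are independent, so the expectation factorises, and
    each pair inside \<open>U\<close> has mean \<open>1 + p * (x - 1)\<close>.\<close>
  define \<phi> where "\<phi> e b = (if e \<subseteq> U \<and> b then x else 1)" for e :: "nat set" and b
  have prod: "x ^ card (induced_edges {e \<in> all_pairs n. f e} U) = (\<Prod>e\<in>all_pairs n. \<phi> e (f e))" for f
  proof -
    have "(\<Prod>e\<in>all_pairs n. \<phi> e (f e)) = (\<Prod>e\<in>{e \<in> all_pairs n. e \<subseteq> U \<and> f e}. x)"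
      using finite_all_pairs by (subst prod.inter_filter) (simp_all add: \<phi>_def)
    also have "{e \<in> all_pairs n. e \<subseteq> U \<and> f e} = induced_edges {e \<in> all_pairs n. f e} U"
      by (auto simp: induced_edges_def)
    finally show ?thesis by simp
  qed
  have "measure_pmf.expectation (gnp n p) (\<lambda>E. x ^ card (induced_edges E U)) =
        (\<Prod>e\<in>all_pairs n. measure_pmf.expectation (bernoulli_pmf p) (\<phi> e))"
    unfolding gnp_def integral_map_pmf prod using assms
    by (intro expectation_prod_Pi_pmf finite_all_pairs integrable_measure_pmf_finite) (auto simp: \<phi>_def)
  also have "\<dots> = (\<Prod>e\<in>all_pairs n. if e \<subseteq> U then 1 + p * (x - 1) else 1)"
    using assms by (intro prod.cong) (auto simp: \<phi>_def algebra_simps)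
  also have "\<dots> = (1 + p * (x - 1)) ^ card {e \<in> all_pairs n. e \<subseteq> U}"
    using finite_all_pairs by (subst prod.inter_filter[symmetric]) simp_all
  also have "{e \<in> all_pairs n. e \<subseteq> U} = {e. e \<subseteq> U \<and> card e = 2}"
    using assms(4) by (auto simp: all_pairs_eq)
  also have "card \<dots> = card U choose 2"
    by (rule n_subsets[OF fin])
  finally show ?thesis .
qed

text \<open>Chernoff's method: Markov's inequality for \<open>x\<close> to the number of edges, then
  \<open>1 + t \<le> exp t\<close>. The base \<open>x\<close> stays free because the dense and
  sparse regimes need different choices.\<close>

lemma prob_many_induced_edges_le:
  fixes p x m :: real
  assumes "0 \<le> p" "p \<le> 1" "1 \<le> x" "U \<subseteq> {..<n}"
  shows "measure_pmf.prob (gnp n p) {E. m \<le> card (induced_edges E U)} \<le>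
         exp (p * (x - 1) * (card U)\<^sup>2 / 2 - m * ln x)"
proof -
  let ?X = "\<lambda>E. card (induced_edges E U)"
  have "measure_pmf.prob (gnp n p) {E. m \<le> ?X E} \<le>
        measure_pmf.prob (gnp n p) {E \<in> space (measure_pmf (gnp n p)). x powr m \<le> x ^ ?X E}"
    using assms by (intro measure_pmf.finite_measure_mono)
      (auto simp flip: powr_realpow intro!: powr_mono)
  also have "\<dots> \<le> measure_pmf.expectation (gnp n p) (\<lambda>E. x ^ ?X E) / x powr m"
    using assms by (intro integral_Markov_inequality_measure[where A = "{}"]
        integrable_measure_pmf_finite finite_set_pmf_gnp) auto
  also have "\<dots> = (1 + p * (x - 1)) ^ (card U choose 2) / x powr m"
    using assms by (subst expectation_power_induced_edges) auto
  also have "(1 + p * (x - 1)) ^ (card U choose 2) \<le> exp (p * (x - 1)) ^ (card U choose 2)"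
    using assms exp_ge_add_one_self[of "p * (x - 1)"] by (intro power_mono) auto
  also have "\<dots> = exp (p * (x - 1) * (card U choose 2))"
    by (simp add: exp_of_nat2_mult)
  also have "\<dots> \<le> exp (p * (x - 1) * ((card U)\<^sup>2 / 2))"
  proof -
    have "(card U choose 2) * 2 \<le> (card U)\<^sup>2"
      unfolding choose_two
      by (rule order.trans[OF div_times_less_eq_dividend]) (simp add: power2_eq_square)
    then have "real ((card U choose 2) * 2) \<le> real ((card U)\<^sup>2)"
      by (simp only: of_nat_le_iff)
    then have "real (card U choose 2) \<le> (card U)\<^sup>2 / 2"
      by simp
    then show ?thesis
      using assms by (intro iffD2[OF exp_le_cancel_iff] mult_left_mono) auto
  qed
  also have "\<dots> / x powr m = exp (p * (x - 1) * (card U)\<^sup>2 / 2 - m * ln x)"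
    using assms by (simp add: exp_diff powr_def)
  finally show ?thesis using assms by (simp add: divide_right_mono)
qed

text \<open>Union bound. The bound for \<open>U\<close> is \<open>y ^ card U\<close> with
  \<open>y = 1 / n ^ 2\<close>, and summing this over all nonempty subsets gives
  \<open>(1 + y) ^ n - 1\<close> exactly, without sorting the sets by size.\<close>

lemma prob_some_set_bad_le:
  fixes z :: real and bad :: "nat set \<Rightarrow> nat set set set"
  assumes "0 < n"
    and "\<And>U. U \<subseteq> {..<n} \<Longrightarrow> U \<noteq> {} \<Longrightarrow> card U \<le> z \<Longrightarrow>
           measure_pmf.prob (gnp n p) (bad U) \<le> exp (- 2 * card U * ln n)"
  shows "measure_pmf.prob (gnp n p) {E. \<exists>U\<subseteq>{..<n}. U \<noteq> {} \<and> card U \<le> z \<and> E \<in> bad U} \<le> exp (1 / n) - 1"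
proof -
  let ?S = "{U. U \<subseteq> {..<n} \<and> U \<noteq> {} \<and> card U \<le> z}"
  have fin: "finite ?S" by (rule finite_subset[of _ "Pow {..<n}"]) auto
  define y where "y = 1 / real n ^ 2"
  have y: "exp (- 2 * real k * ln n) = y ^ k" for k
  proof -
    have "y = exp (- 2 * ln n)"
      using assms(1) by (simp add: y_def exp_minus exp_double inverse_eq_divide)
    then show ?thesis by (simp add: algebra_simps flip: exp_of_nat_mult)
  qed
  have "measure_pmf.prob (gnp n p) {E. \<exists>U\<subseteq>{..<n}. U \<noteq> {} \<and> card U \<le> z \<and> E \<in> bad U} =
        measure_pmf.prob (gnp n p) (\<Union>U\<in>?S. bad U)"
    by (intro arg_cong[of _ _ "measure_pmf.prob _"]) auto
  also have "\<dots> \<le> (\<Sum>U\<in>?S. measure_pmf.prob (gnp n p) (bad U))"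
    using fin by (intro measure_UNION_le) auto
  also have "\<dots> \<le> (\<Sum>U\<in>?S. y ^ card U)"
    using assms(2) y by (intro sum_mono) auto
  also have "\<dots> \<le> (\<Sum>U\<in>Pow {..<n} - {{}}. y ^ card U)"
    by (intro sum_mono2) (auto simp: y_def)
  also have "\<dots> = (\<Sum>U\<in>Pow {..<n}. y ^ card U) - 1"
    by (subst sum_diff1) auto
  also have "(\<Sum>U\<in>Pow {..<n}. y ^ card U) = (y + 1) ^ n"
    using prod_add[of "{..<n}" "\<lambda>_. y" "\<lambda>_. 1"] by simp
  also have "\<dots> \<le> exp y ^ n"
    using exp_ge_add_one_self[of y] by (intro power_mono) (auto simp: y_def add.commute)
  also have "\<dots> = exp (1 / n)"
    using assms(1) by (simp add: y_def power2_eq_square field_simps flip: exp_of_nat_mult)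
  finally show ?thesis by simp
qed

section \<open>Deletion number and the location of the chromatic number\<close>

lemma chromatic_number_le_iff:
  assumes "E \<subseteq> all_pairs n"
  shows "chromatic_number n E \<le> k \<longleftrightarrow> colourable E {..<n} k"
proof -
  have eq: "(\<exists>c. proper_colouring n E j c) \<longleftrightarrow> colourable E {..<n} j" for j
  proof -
    have "u < n" "v < n" if "{u, v} \<in> E" for u v
      using that assms by (auto simp: all_pairs_eq)
    then show ?thesis
      unfolding colourable_def proper_colouring_def
      by (intro arg_cong[of _ _ Ex] ext) auto
  qed
  have "colourable E {..<n} n"
    by (rule colourableI[of _ "\<lambda>v. v"]) auto
  then have "colourable E {..<n} (chromatic_number n E)"
    unfolding chromatic_number_def eq by (rule LeastI)
  then show ?thesis
    using colourable_mono Least_le[of "colourable E {..<n}" k]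
    unfolding chromatic_number_def eq by blast
qed

text \<open>The distance, counted in vertices, from being \<open>k\<close>-colourable. It vanishes
  exactly when the whole graph is \<open>k\<close>-colourable, so a lower bound on the probability
  of that event is a lower bound on the probability of the value 0.\<close>

definition deletion_number :: "nat \<Rightarrow> nat \<Rightarrow> nat set set \<Rightarrow> nat" where
  "deletion_number n k E = (LEAST m. \<exists>S\<subseteq>{..<n}. card S = m \<and> colourable E ({..<n} - S) k)"

lemma deletion_number_witness:
  "\<exists>S\<subseteq>{..<n}. card S = deletion_number n k E \<and> colourable E ({..<n} - S) k"
  unfolding deletion_number_def
  by (rule LeastI[of _ n]) (intro exI[of _ "{..<n}"], simp add: colourable_empty)

lemma deletion_number_le:
  "S \<subseteq> {..<n} \<Longrightarrow> colourable E ({..<n} - S) k \<Longrightarrow> deletion_number n k E \<le> card S"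
  unfolding deletion_number_def by (rule Least_le) blast

text \<open>The graphs agree away from \<open>i\<close>, so adding \<open>i\<close> to an optimal
  deleted set for \<open>E'\<close> gives a valid deleted set for \<open>E\<close>.\<close>

lemma deletion_number_Lipschitz:
  assumes "i < n" "\<And>e. i \<notin> e \<Longrightarrow> e \<in> E \<longleftrightarrow> e \<in> E'"
  shows "deletion_number n k E \<le> deletion_number n k E' + 1"
proof -
  obtain S where S: "S \<subseteq> {..<n}" "card S = deletion_number n k E'" "colourable E' ({..<n} - S) k"
    using deletion_number_witness by blast
  have "colourable E ({..<n} - insert i S) k"
  proof -
    obtain c where c: "\<forall>v\<in>{..<n} - S. c v < k"
      "\<forall>u\<in>{..<n} - S. \<forall>v\<in>{..<n} - S. {u, v} \<in> E' \<longrightarrow> u \<noteq> v \<longrightarrow> c u \<noteq> c v"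
      using S(3) by (rule colourableE)
    show ?thesis
      by (rule colourableI[of _ c]) (use c assms(2) in auto)
  qed
  then have "deletion_number n k E \<le> card (insert i S)"
    using S(1) assms(1) by (intro deletion_number_le) auto
  also have "\<dots> \<le> card S + 1"
    by (simp add: card_insert_le_m1 card_insert_if finite_subset[OF S(1)])
  finally show ?thesis using S(2) by simp
qed

lemma variance_deletion_number_le:
  "measure_pmf.variance (gnp n p) (\<lambda>E. real (deletion_number n k E)) \<le> n"
proof -
  define B where "B i = {{u, i} | u. u < i}" for i :: nat
  \<comment> \<open>The larger endpoint identifies the block, which makes distinct blocks
    disjoint.\<close>
  have Max: "Max e = i" if "e \<in> B i" for e i
    using that by (auto simp: B_def max_def)
  have "measure_pmf.variance (gnp n p) (\<lambda>E. real (deletion_number n k E)) =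
    measure_pmf.variance (Pi_pmf (\<Union>i<n. B i) False (\<lambda>_. bernoulli_pmf p))
      (\<lambda>f. real (deletion_number n k {e \<in> all_pairs n. f e}))"
    by (simp add: gnp_def B_def flip: all_pairs_eq_Union)
  also have "\<dots> \<le> n"
  proof (rule variance_Pi_pmf_le)
    show "finite (B i)" for i
      unfolding B_def by simp
    show "B i \<inter> B j = {}" if "i \<noteq> j" for i j
      using Max that by blast
    show "finite (set_pmf (bernoulli_pmf p))" by (rule finite)
    fix i and g h :: "nat set \<Rightarrow> bool"
    assume i: "i < n" and gh: "\<And>x. x \<notin> B i \<Longrightarrow> g x = h x"
    have "e \<in> {e \<in> all_pairs n. g e} \<longleftrightarrow> e \<in> {e \<in> all_pairs n. h e}" if "i \<notin> e" for e
      using that gh[of e] by (auto simp: B_def)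
    then have "deletion_number n k {e \<in> all_pairs n. g e} \<le> deletion_number n k {e \<in> all_pairs n. h e} + 1"
      "deletion_number n k {e \<in> all_pairs n. h e} \<le> deletion_number n k {e \<in> all_pairs n. g e} + 1"
      by (intro deletion_number_Lipschitz[OF i]; simp)+
    then show "\<bar>real (deletion_number n k {e \<in> all_pairs n. g e}) -
        real (deletion_number n k {e \<in> all_pairs n. h e})\<bar> \<le> 1"
      by linarith
  qed
  finally show ?thesis .
qed

text \<open>Chebyshev twice. The value 0 lies at distance \<open>m\<close> from the mean
  \<open>m\<close>, so its probability \<open>4 / w\<^sup>2\<close> or more forces
  \<open>m \<le> w * sqrt n / 2\<close>. Exceeding \<open>w * sqrt n\<close> is then a deviation of
  at least \<open>w * sqrt n / 2\<close>, which has probability at most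
  \<open>4 / w\<^sup>2\<close>.\<close>

lemma prob_deletion_number_large_le:
  fixes w :: real
  assumes "0 < n" "0 < w" "4 / w\<^sup>2 \<le> measure_pmf.prob (gnp n p) {E. deletion_number n k E = 0}"
  shows "measure_pmf.prob (gnp n p) {E. w * sqrt n < deletion_number n k E} \<le> 4 / w\<^sup>2"
proof -
  let ?M = "gnp n p" and ?Y = "\<lambda>E. real (deletion_number n k E)"
  define m where "m = measure_pmf.expectation ?M ?Y"
  have cheb: "measure_pmf.prob ?M {E. a \<le> \<bar>?Y E - m\<bar>} \<le> n / a\<^sup>2" if "0 < a" for a
  proof -
    have "measure_pmf.prob ?M {E \<in> space (measure_pmf ?M). a \<le> \<bar>?Y E - m\<bar>} \<le>
        measure_pmf.variance ?M ?Y / a\<^sup>2"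
      unfolding m_def using that
      by (intro measure_pmf.Chebyshev_inequality integrable_measure_pmf_finite finite_set_pmf_gnp) auto
    also have "\<dots> \<le> n / a\<^sup>2"
      by (intro divide_right_mono variance_deletion_number_le) auto
    finally show ?thesis by simp
  qed
  have m: "m \<le> w * sqrt n / 2"
  proof (cases "0 < m")
    case True
    have "4 / w\<^sup>2 \<le> measure_pmf.prob ?M {E. m \<le> \<bar>?Y E - m\<bar>}"
      using assms(3) by (rule order.trans) (intro measure_pmf.finite_measure_mono, auto)
    also have "\<dots> \<le> n / m\<^sup>2" using True by (rule cheb)
    finally have "4 * m\<^sup>2 \<le> n * w\<^sup>2" using True assms(2) by (simp add: field_simps)
    also have "\<dots> = (w * sqrt n)\<^sup>2" by (simp add: power_mult_distrib)
    finally have "(2 * m)\<^sup>2 \<le> (w * sqrt n)\<^sup>2" by (simp add: power_mult_distrib)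
    then have "2 * m \<le> w * sqrt n" by (rule power2_le_imp_le) (use assms(2) in auto)
    then show ?thesis by simp
  next
    case False
    moreover have "0 \<le> w * sqrt n / 2" using assms(2) by simp
    ultimately show ?thesis by linarith
  qed
  have "measure_pmf.prob ?M {E. w * sqrt n < ?Y E} \<le>
        measure_pmf.prob ?M {E. w * sqrt n / 2 \<le> \<bar>?Y E - m\<bar>}"
    using m by (intro measure_pmf.finite_measure_mono) auto
  also have "\<dots> \<le> n / (w * sqrt n / 2)\<^sup>2"
    using assms by (intro cheb) auto
  also have "\<dots> = 4 / w\<^sup>2"
    using assms by (simp add: power_mult_distrib power_divide field_simps)
  finally show ?thesis .
qed

text \<open>The left end \<open>k\<close> is fixed before \<open>L\<close> and \<open>bad\<close>,
  so it depends only on \<open>n\<close>, \<open>p\<close> and \<open>w\<close>. Three events can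
  fail: the chromatic number is below \<open>k\<close>, more than \<open>w * sqrt n\<close> vertices
  must be deleted, or \<open>bad\<close> occurs. Otherwise the deleted vertices are recoloured with
  at most \<open>L\<close> fresh colours.\<close>

lemma chromatic_number_window:
  fixes w :: real
  assumes "0 < n" "2 \<le> w"
  obtains k :: nat where "\<And>(L::real) bad.
    (\<And>E S. E \<subseteq> all_pairs n \<Longrightarrow> E \<notin> bad \<Longrightarrow> S \<subseteq> {..<n} \<Longrightarrow> card S \<le> w * sqrt n \<Longrightarrow>
       \<exists>j. colourable E S j \<and> real j \<le> L) \<Longrightarrow>
    1 - 8 / w\<^sup>2 - measure_pmf.prob (gnp n p) bad \<le>
      measure_pmf.prob (gnp n p) {E. k \<le> real (chromatic_number n E) \<and> real (chromatic_number n E) \<le> k + L}"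
proof -
  let ?P = "measure_pmf.prob (gnp n p)"
  define ok where "ok j \<longleftrightarrow> 4 / w\<^sup>2 \<le> ?P {E. chromatic_number n E \<le> j}" for j
  have AE: "AE E in gnp n p. E \<subseteq> all_pairs n"
    by (intro AE_pmfI set_pmf_gnp_subset)
  have chi: "chromatic_number n E \<le> n" if "E \<subseteq> all_pairs n" for E
    using that by (subst chromatic_number_le_iff) (auto intro!: colourableI[of _ "\<lambda>v. v"])
  have "?P {E. chromatic_number n E \<le> n} = 1"
    using AE chi by (subst measure_pmf.prob_eq_1) (auto elim: eventually_mono)
  moreover have "4 / w\<^sup>2 \<le> 1"
    using power_mono[OF assms(2), of 2] by (subst pos_divide_le_eq) (use assms(2) in auto)
  ultimately have "ok n" by (simp add: ok_def)
  define k where "k = (LEAST j. ok j)"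
  have ok: "ok k" unfolding k_def using \<open>ok n\<close> by (rule LeastI)
  have low: "?P {E. chromatic_number n E < k} \<le> 4 / w\<^sup>2"
  proof (cases k)
    case (Suc j)
    \<comment> \<open>For \<open>k = j + 1\<close>, being below \<open>k\<close> means being at most
      \<open>j\<close>, and minimality of \<open>k\<close> makes that unlikely.\<close>
    then have "\<not> ok j" using not_less_Least[of j ok] by (simp add: k_def)
    then show ?thesis by (simp add: ok_def Suc less_Suc_eq_le)
  qed simp
  have "4 / w\<^sup>2 \<le> ?P {E. chromatic_number n E \<le> k}"
    using ok by (simp add: ok_def)
  also have "\<dots> \<le> ?P {E. deletion_number n k E = 0}"
  proof (rule measure_pmf.finite_measure_mono_AE)
    show "AE E in gnp n p. E \<in> {E. chromatic_number n E \<le> k} \<longrightarrow> E \<in> {E. deletion_number n k E = 0}"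
      using AE
    proof eventually_elim
      case (elim E)
      then show ?case
        using deletion_number_le[of "{}" n E k] chromatic_number_le_iff[of E n k] by auto
    qed
  qed simp
  finally have high: "?P {E. w * sqrt n < deletion_number n k E} \<le> 4 / w\<^sup>2"
    using assms by (intro prob_deletion_number_large_le) auto
  show thesis
  proof (rule that[of k])
    fix L :: real and bad
    assume few: "\<And>E S. E \<subseteq> all_pairs n \<Longrightarrow> E \<notin> bad \<Longrightarrow> S \<subseteq> {..<n} \<Longrightarrow>
      card S \<le> w * sqrt n \<Longrightarrow> \<exists>j. colourable E S j \<and> real j \<le> L"
    let ?W = "{E. k \<le> real (chromatic_number n E) \<and> real (chromatic_number n E) \<le> k + L}"
    let ?X = "{E. chromatic_number n E < k} \<union> {E. w * sqrt n < deletion_number n k E} \<union> bad"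
    have "1 = ?P UNIV" by simp
    also have "\<dots> \<le> ?P (?W \<union> ?X)"
    proof (rule measure_pmf.finite_measure_mono_AE)
      show "AE E in gnp n p. E \<in> UNIV \<longrightarrow> E \<in> ?W \<union> ?X"
        using AE
      proof eventually_elim
        case (elim E)
        have "real (chromatic_number n E) \<le> k + L" if good: "E \<notin> bad" "deletion_number n k E \<le> w * sqrt n"
        proof -
          obtain S where S: "S \<subseteq> {..<n}" "card S = deletion_number n k E" "colourable E ({..<n} - S) k"
            using deletion_number_witness by blast
          then obtain j where j: "colourable E S j" "real j \<le> L"
            using few[OF elim good(1) S(1)] good(2) by auto
          have "colourable E (({..<n} - S) \<union> S) (k + j)"
            using S(3) j(1) by (rule colourable_Un)
          moreover have "({..<n} - S) \<union> S = {..<n}" using S(1) by auto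
          ultimately have "chromatic_number n E \<le> k + j"
            using elim by (simp add: chromatic_number_le_iff)
          then show ?thesis using j(2) by linarith
        qed
        then show ?case by auto
      qed
    qed simp
    also have "\<dots> \<le> ?P ?W + ?P ?X"
      by (rule measure_Un_le) auto
    also have "?P ?X \<le> ?P {E. chromatic_number n E < k} + ?P {E. w * sqrt n < deletion_number n k E} + ?P bad"
      using measure_Un_le[of "{E. chromatic_number n E < k} \<union> {E. w * sqrt n < deletion_number n k E}" "gnp n p" bad]
        measure_Un_le[of "{E. chromatic_number n E < k}" "gnp n p" "{E. w * sqrt n < deletion_number n k E}"]
      by simp
    also have "\<dots> \<le> 4 / w\<^sup>2 + 4 / w\<^sup>2 + ?P bad"
      using low high by (intro add_mono) auto
    finally show "1 - 8 / w\<^sup>2 - ?P bad \<le> ?P ?W"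
      by simp
  qed
qed

subsection \<open>Colouring locally sparse graphs\<close>

lemma exists_vertex_degree_less:
  fixes D :: real
  assumes "E \<subseteq> all_pairs n" "finite U" "U \<noteq> {}" "card (induced_edges E U) < D"
  shows "\<exists>v\<in>U. card (nbrs E U v) < 2 * D / card U"
proof -
  obtain v where v: "v \<in> U" "card U * card (nbrs E U v) \<le> 2 * card (induced_edges E U)"
    using exists_low_degree_vertex[OF assms(2,3), of E] assms(1) by (auto simp: all_pairs_eq)
  have "real (card U * card (nbrs E U v)) \<le> real (2 * card (induced_edges E U))"
    using v(2) by (simp only: of_nat_le_iff)
  then have "real (card (nbrs E U v)) * card U < 2 * D" using assms(4) by (simp add: mult.commute)
  moreover have "0 < real (card U)" using assms(2,3) by (simp add: card_gt_0_iff)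
  ultimately show ?thesis using v(1) by (auto simp: pos_less_divide_eq)
qed

lemma colourable_nat_ceiling:
  fixes D :: real
  assumes "finite S"
    and "\<And>U. U \<subseteq> S \<Longrightarrow> U \<noteq> {} \<Longrightarrow> \<exists>v\<in>U. card (nbrs E U v) < D"
  shows "colourable E S (nat \<lceil>D\<rceil>)"
proof (rule colourable_if_degenerate[OF assms(1)])
  fix U assume "U \<subseteq> S" "U \<noteq> {}"
  then obtain v where "v \<in> U" "card (nbrs E U v) < D" using assms(2) by blast
  then show "\<exists>v\<in>U. card (nbrs E U v) < nat \<lceil>D\<rceil>"
    by (intro bexI[of _ v]) linarith+
qed

text \<open>Since \<open>1 / (1 - q) = 1 + q / (1 - q)\<close>, the bound
  \<open>1 + t \<le> exp t\<close> applies to the reciprocal. The constant is uniform for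
  \<open>q \<le> q1\<close>; this is where edge probabilities must stay away from 1.\<close>

lemma exp_le_one_minus:
  fixes q q1 :: real
  assumes "0 \<le> q" "q \<le> q1" "q1 < 1"
  shows "exp (- (q / (1 - q1))) \<le> 1 - q"
proof -
  have "q / (1 - q) \<le> q / (1 - q1)"
    using assms by (intro divide_left_mono) auto
  then have "1 / (1 - q) \<le> 1 + q / (1 - q1)"
    using assms by (simp add: field_simps)
  also have "\<dots> \<le> exp (q / (1 - q1))" by (rule exp_ge_add_one_self)
  finally show ?thesis
    using assms by (simp add: exp_minus field_simps)
qed

text \<open>Greedy independent sets of size at least \<open>ln (z p / M) / (2 q / (1 - q1))\<close> are removed
  until fewer than \<open>sqrt (z M / p)\<close> vertices remain; these are coloured by degeneracy.\<close>

lemma colourable_locally_sparse: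
  fixes p q q1 \<epsilon> M z :: real
  assumes "finite S" "card S \<le> z" "0 < p" "0 < \<epsilon>" "1 \<le> \<epsilon> * M" "M < z * p"
    and q: "q = (1 + 2 * \<epsilon>) * p" "q \<le> q1" "q1 < 1"
    and low: "\<And>U. U \<subseteq> S \<Longrightarrow> U \<noteq> {} \<Longrightarrow> \<exists>v\<in>U. card (nbrs E U v) < max ((1 + \<epsilon>) * p * card U) M"
  shows "\<exists>k. colourable E S k \<and>
    real k \<le> max ((1 + \<epsilon>) * sqrt (z * p * M)) M + 1 + z * (2 * q / (1 - q1)) / ln (z * p / M)"
proof -
  have M: "0 < M" using assms(4,5) by (metis mult_nonneg_nonpos2 not_le_imp_less not_one_le_zero
        order_less_imp_le order_trans mult.commute)
  have z: "0 < z" using assms(3,6) M by (smt (verit) mult_nonpos_nonneg)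
  have q0: "0 < q" using assms(3,4) by (simp add: q)
  \<comment> \<open>At \<open>u0\<close> vertices the two terms \<open>p * card U\<close> and
    \<open>M\<close> balance. The cutoff \<open>u1\<close> is the geometric mean of \<open>z\<close>
    and \<open>u0\<close>, so shrinking from \<open>u1\<close> to \<open>u0\<close> leaves half of
    \<open>ln (z * p / M)\<close> to spend, at cost \<open>q / (1 - q1)\<close> per greedy round;
    \<open>\<kappa>\<close> is the resulting number of rounds.\<close>
  define u0 where "u0 = M / p"
  define u1 where "u1 = sqrt (z * u0)"
  define \<kappa> where "\<kappa> = ln (z * p / M) / (2 * q / (1 - q1))"
  have u0: "0 < u0" using M assms(3) by (simp add: u0_def)
  have ln: "0 < ln (z * p / M)" using M assms(6) by simp
  have \<kappa>: "0 < \<kappa>" unfolding \<kappa>_def using ln q0 q by simp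
  have u1: "p * u1 = sqrt (z * p * M)"
  proof -
    have "p * u1 = sqrt (p\<^sup>2) * sqrt (z * u0)" using assms(3) by (simp add: u1_def)
    also have "\<dots> = sqrt (p\<^sup>2 * (z * u0))" by (simp only: real_sqrt_mult)
    also have "p\<^sup>2 * (z * u0) = z * p * M" using assms(3) by (simp add: u0_def power2_eq_square)
    finally show ?thesis .
  qed
  define D where "D = max ((1 + \<epsilon>) * sqrt (z * p * M)) M"
  have "\<exists>I\<subseteq>U. \<kappa> \<le> card I \<and> colourable E I 1" if U: "U \<subseteq> S" "u1 \<le> card U" for U
  proof -
    \<comment> \<open>Rounding down loses nothing: \<open>j\<close> rounds produce
      \<open>j + 1\<close> vertices, which is at least \<open>\<kappa>\<close>.\<close>
    define j where "j = nat \<lfloor>\<kappa>\<rfloor>"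
    have j: "real j \<le> \<kappa>" "\<kappa> \<le> real (j + 1)" using \<kappa> by (auto simp: j_def) linarith
    have "u0 = u1 * sqrt (M / (z * p))"
    proof -
      have "u1 * sqrt (M / (z * p)) = sqrt (z * u0 * (M / (z * p)))"
        by (simp only: u1_def real_sqrt_mult)
      also have "z * u0 * (M / (z * p)) = u0\<^sup>2"
        using z assms(3) by (simp add: u0_def power2_eq_square)
      finally show ?thesis using u0 by simp
    qed
    also have "sqrt (M / (z * p)) = exp (- (ln (z * p / M) / 2))"
    proof -
      have "(exp (- (ln (z * p / M) / 2)))\<^sup>2 = exp (- ln (z * p / M))"
        by (simp add: exp_double[symmetric])
      also have "\<dots> = M / (z * p)" using M z assms(3) by (simp add: exp_minus)
      finally show ?thesis by (intro real_sqrt_unique) auto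
    qed
    also have "ln (z * p / M) / 2 = \<kappa> * (q / (1 - q1))"
      using q0 q(3) by (simp add: \<kappa>_def field_simps)
    also have "u1 * exp (- (\<kappa> * (q / (1 - q1)))) \<le> u1 * exp (- (j * (q / (1 - q1))))"
    proof -
      have "j * (q / (1 - q1)) \<le> \<kappa> * (q / (1 - q1))"
        using j q0 q(3) by (intro mult_right_mono) auto
      then show ?thesis using z u0 by (intro mult_left_mono) (auto simp: u1_def)
    qed
    also have "\<dots> = u1 * exp (- (q / (1 - q1))) ^ j"
      by (simp flip: exp_of_nat_mult)
    also have "\<dots> \<le> card U * (1 - q) ^ j"
      using U(2) q0 q by (intro mult_mono power_mono exp_le_one_minus) auto
    finally have size: "u0 \<le> card U * (1 - q) ^ j" .
    have "\<exists>v\<in>V. card (nbrs E V v) + 1 \<le> q * card V" if V: "V \<subseteq> U" "u0 \<le> card V" for V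
    proof -
      have Mp: "M \<le> p * card V" using V(2) assms(3) by (simp add: u0_def field_simps)
      have "V \<noteq> {}" using V(2) u0 by auto
      then obtain v where v: "v \<in> V" "card (nbrs E V v) < max ((1 + \<epsilon>) * p * card V) M"
        using low[of V] V(1) U(1) by blast
      have "0 \<le> \<epsilon> * (p * card V)" using assms(3,4) by simp
      then have "max ((1 + \<epsilon>) * p * card V) M = (1 + \<epsilon>) * p * card V"
        using Mp by (simp add: algebra_simps)
      \<comment> \<open>The extra 1 for the chosen vertex is absorbed by a second
        \<open>\<epsilon>\<close>, hence the factor \<open>1 + 2 * \<epsilon>\<close> in
        \<open>q\<close>.\<close>
      moreover have "1 \<le> \<epsilon> * (p * card V)"
        using assms(4,5) Mp by (meson mult_left_mono order.trans less_imp_le)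
      ultimately have "card (nbrs E V v) + 1 \<le> q * card V"
        using v(2) by (simp add: q algebra_simps)
      then show ?thesis using v(1) by blast
    qed
    then obtain I where "I \<subseteq> U" "j + 1 \<le> card I" "colourable E I 1"
      using exists_independent_subset[of U u0 q E j] size u0 q0 q finite_subset[OF U(1) assms(1)]
      by auto
    moreover from this j(2) have "\<kappa> \<le> card I" by linarith
    ultimately show ?thesis by blast
  qed
  moreover have "colourable E U (nat \<lceil>D\<rceil>)" if U: "U \<subseteq> S" "card U < u1" for U
  proof (rule colourable_nat_ceiling)
    show "finite U" using U(1) assms(1) finite_subset by blast
    fix V assume V: "V \<subseteq> U" "V \<noteq> {}"
    then obtain v where v: "v \<in> V" "card (nbrs E V v) < max ((1 + \<epsilon>) * p * card V) M"
      using low[of V] U(1) by blast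
    have "card V \<le> card U" by (intro card_mono V(1) finite_subset[OF U(1) assms(1)])
    then have "(1 + \<epsilon>) * (p * card V) \<le> (1 + \<epsilon>) * (p * u1)"
      using U(2) assms(3,4) by (intro mult_left_mono) auto
    then have "max ((1 + \<epsilon>) * p * card V) M \<le> D" by (auto simp: D_def u1 mult.assoc)
    then show "\<exists>v\<in>V. card (nbrs E V v) < D" using v by force
  qed
  ultimately obtain k where k: "colourable E S k" "real k \<le> nat \<lceil>D\<rceil> + card S / \<kappa>"
    using colourable_by_peeling[OF assms(1) \<kappa>, of u1 E "nat \<lceil>D\<rceil>"] by blast
  have "0 < D" using M by (auto simp: D_def)
  then have "nat \<lceil>D\<rceil> \<le> D + 1" by linarith
  moreover have "card S / \<kappa> \<le> z / \<kappa>" using assms(2) \<kappa> by (simp add: divide_right_mono)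
  moreover have "z / \<kappa> = z * (2 * q / (1 - q1)) / ln (z * p / M)" by (simp add: \<kappa>_def)
  ultimately show ?thesis using k unfolding D_def by (intro exI[of _ k]) linarith
qed

lemma ln_le_two_sqrt:
  fixes R :: real
  assumes "1 \<le> R"
  shows "ln R \<le> 2 * sqrt R"
proof -
  have "ln R = 2 * ln (sqrt R)" using assms by (simp add: ln_sqrt)
  also have "ln (sqrt R) \<le> sqrt R" using assms ln_le_minus_one[of "sqrt R"] by simp
  finally show ?thesis by simp
qed

text \<open>Here \<open>L\<close> stands for \<open>ln n\<close>, \<open>R\<close> for
  \<open>z p / ln n\<close> and \<open>K * L\<close> for the degree floor \<open>M\<close>. Because
  \<open>ln R\<close> is at most \<open>R\<close> and \<open>2 * sqrt R\<close>, both
  \<open>L\<close> and \<open>L * sqrt R\<close> are of order at most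
  \<open>zp / ln R\<close>.\<close>

lemma dense_palette_bound:
  fixes L R K \<epsilon> zp :: real
  assumes "1 \<le> L" "1 \<le> K" "0 < \<epsilon>" "\<epsilon> \<le> 1" "1 < R" "K\<^sup>2 \<le> R" "0 \<le> b" "zp = R * L"
  shows "max ((1 + \<epsilon>) * sqrt (zp * (K * L))) (K * L) + 1 + zp * b / ln (zp / (K * L)) \<le>
         (4 * K + 1 + 2 * b) * (zp / ln R)"
proof -
  define X where "X = zp / ln R"
  have lnR: "0 < ln R" using assms(5) by simp
  have X: "X = L * (R / ln R)" by (simp add: X_def assms(8))
  have "ln R \<le> R" using ln_le_minus_one[of R] assms(5) by simp
  then have "1 \<le> R / ln R" using lnR by simp
  then have LX: "L \<le> X" unfolding X using assms(1) mult_left_mono[of 1 "R / ln R" L] by simp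
  have "sqrt R * ln R \<le> sqrt R * (2 * sqrt R)"
    using assms(5) by (intro mult_left_mono ln_le_two_sqrt) auto
  also have "\<dots> = 2 * R" using assms(5) by simp
  finally have "sqrt R \<le> 2 * (R / ln R)" using lnR by (simp add: field_simps)
  then have sX: "L * sqrt R \<le> 2 * X"
    unfolding X using assms(1) mult_left_mono[of "sqrt R" "2 * (R / ln R)" L]
    by (simp add: mult.left_commute)
  have "sqrt (zp * (K * L)) = sqrt K * (L * sqrt R)"
    using assms by (simp add: real_sqrt_mult mult_ac)
  also have "\<dots> \<le> K * (2 * X)"
  proof (rule mult_mono[OF _ sX])
    show "sqrt K \<le> K" using assms(2) by (intro real_le_lsqrt) (auto simp: power2_eq_square)
  qed (use assms in auto)
  finally have "(1 + \<epsilon>) * sqrt (zp * (K * L)) \<le> 2 * (K * (2 * X))"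
    using assms LX by (intro mult_mono) auto
  moreover have "K * L \<le> K * (4 * X)"
    using assms LX by (intro mult_left_mono) auto
  ultimately have 1: "max ((1 + \<epsilon>) * sqrt (zp * (K * L))) (K * L) \<le> 4 * K * X"
    by simp
  \<comment> \<open>As \<open>K\<^sup>2 \<le> R\<close>, dividing by \<open>K\<close> inside the
    logarithm at most halves it.\<close>
  have "sqrt R \<le> R / K"
  proof -
    have "K \<le> sqrt R" using assms(2,6) by (intro real_le_rsqrt)
    then have "K * sqrt R \<le> sqrt R * sqrt R" using assms(5) by (intro mult_right_mono) auto
    then show ?thesis using assms(2,5) by (simp add: field_simps)
  qed
  then have "ln (sqrt R) \<le> ln (R / K)" using assms(2,5) by simp
  then have "ln R / 2 \<le> ln (zp / (K * L))" using assms(1,5) by (simp add: ln_sqrt assms(8))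
  then have "zp * b / ln (zp / (K * L)) \<le> zp * b / (ln R / 2)"
    using lnR assms by (intro frac_le) auto
  then have 2: "zp * b / ln (zp / (K * L)) \<le> 2 * b * X" by (simp add: X_def mult_ac)
  show ?thesis
    using 1 2 LX assms(1) unfolding X_def[symmetric] distrib_right by linarith
qed

subsection \<open>Concentration of the chromatic number\<close>

definition chi_window :: "nat \<Rightarrow> real \<Rightarrow> real \<Rightarrow> nat set set set" where
  "chi_window n a L = {E. a \<le> real (chromatic_number n E) \<and> real (chromatic_number n E) \<le> a + L}"

lemma dense_window:
  fixes \<gamma> :: real
  assumes "0 < \<gamma>" "\<gamma> < 1"
  obtains C R0 :: real where "0 < C" "1 < R0"
    and "\<And>n w p z. 1 \<le> ln (real n) \<Longrightarrow> 2 \<le> w \<Longrightarrow> 0 < p \<Longrightarrow> p \<le> \<gamma> \<Longrightarrow> z = w * sqrt n \<Longrightarrow>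
           R0 \<le> z * p / ln n \<Longrightarrow>
           \<exists>a. 1 - 8 / w\<^sup>2 - (exp (1 / n) - 1) \<le>
             measure_pmf.prob (gnp n p) (chi_window n a (C * (z * p / ln (z * p / ln n))))"
proof -
  \<comment> \<open>With this \<open>\<epsilon>\<close>, \<open>(1 + 2 * \<epsilon>) * p \<le>
    \<gamma> + 2 * \<epsilon> = q1 < 1\<close>. The Chernoff exponent will be at least
    \<open>c\<close> times the edge threshold, so \<open>K = 2 / c\<close> yields the exponent the
    union bound needs. \<open>K2\<close> also covers the factor 2 from edges to degrees and the
    demand \<open>1 \<le> \<epsilon> * M\<close>; \<open>R0\<close> ensures
    \<open>M < z * p\<close>.\<close>
  define \<epsilon> where "\<epsilon> = (1 - \<gamma>) / 4"
  define q1 where "q1 = (1 + \<gamma>) / 2"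
  define c where "c = ln (1 + \<epsilon>) - \<epsilon> / (1 + \<epsilon>)"
  define K where "K = 2 / c"
  define K2 where "K2 = max (2 * K) (max (1 / \<epsilon>) 1)"
  define b where "b = 2 * (1 + 2 * \<epsilon>) / (1 - q1)"
  define C where "C = 4 * K2 + 1 + 2 * b"
  define R0 where "R0 = K2\<^sup>2 + 1"
  have \<epsilon>: "0 < \<epsilon>" "\<epsilon> \<le> 1" "q1 < 1" using assms by (auto simp: \<epsilon>_def q1_def)
  have c: "0 < c"
  proof -
    \<comment> \<open>Strictness holds because \<open>ln x = x - 1\<close> only at
      \<open>x = 1\<close>.\<close>
    have "ln (1 / (1 + \<epsilon>)) < 1 / (1 + \<epsilon>) - 1"
      using \<epsilon> ln_eq_minus_one[of "1 / (1 + \<epsilon>)"] ln_le_minus_one[of "1 / (1 + \<epsilon>)"] by fastforce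
    moreover have "1 / (1 + \<epsilon>) - 1 = - (\<epsilon> / (1 + \<epsilon>))" using \<epsilon> by (simp add: field_simps)
    ultimately show ?thesis using \<epsilon> by (simp add: c_def ln_div)
  qed
  have K: "0 < K" using c by (simp add: K_def)
  have K2: "1 \<le> K2" "2 * K \<le> K2" "1 / \<epsilon> \<le> K2" by (auto simp: K2_def)
  have "0 < K2\<^sup>2" using K2(1) by simp
  then have R0: "1 < R0" unfolding R0_def by linarith
  have b: "0 < b" using \<epsilon> by (simp add: b_def)
  show thesis
  proof (rule that[of C R0])
    show "0 < C" using K2 b by (simp add: C_def)
    show "1 < R0" by (rule R0)
    fix n :: nat and w p z :: real
    assume n: "1 \<le> ln (real n)" and w: "2 \<le> w" and p: "0 < p" "p \<le> \<gamma>"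
      and z: "z = w * sqrt n" and R: "R0 \<le> z * p / ln n"
    have n0: "0 < n" using n by (cases n) auto
    have p1: "p \<le> 1" using p assms by simp
    define D where "D U = max ((1 + \<epsilon>) * p * (real (card U))\<^sup>2 / 2) (K * card U * ln n)" for U :: "nat set"
    define bad where "bad U = {E. D U \<le> card (induced_edges E U)}" for U :: "nat set"
    have prob: "measure_pmf.prob (gnp n p) (bad U) \<le> exp (- 2 * card U * ln n)" if U: "U \<subseteq> {..<n}" for U
    proof -
      have "measure_pmf.prob (gnp n p) (bad U) \<le>
          exp (p * (1 + \<epsilon> - 1) * (real (card U))\<^sup>2 / 2 - D U * ln (1 + \<epsilon>))"
        unfolding bad_def using prob_many_induced_edges_le[of p "1 + \<epsilon>" U n "D U"] p p1 \<epsilon> U by simp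
      also have "\<dots> \<le> exp (- 2 * card U * ln n)"
      proof -
        have "(1 + \<epsilon>) * (p * (real (card U))\<^sup>2 / 2) \<le> D U" by (simp add: D_def mult.assoc)
        then have "p * (real (card U))\<^sup>2 / 2 \<le> D U / (1 + \<epsilon>)" using \<epsilon> by (simp add: field_simps)
        then have "p * (1 + \<epsilon> - 1) * (real (card U))\<^sup>2 / 2 \<le> \<epsilon> * (D U / (1 + \<epsilon>))"
          using \<epsilon> mult_left_mono[of "p * (real (card U))\<^sup>2 / 2" "D U / (1 + \<epsilon>)" \<epsilon>]
          by (simp add: mult.assoc mult.left_commute)
        moreover have "c * (K * card U * ln n) \<le> c * D U"
          using c by (intro mult_left_mono) (auto simp: D_def)
        moreover have "c * (K * card U * ln n) = 2 * card U * ln n" using c by (simp add: K_def)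
        moreover have "c * D U = D U * ln (1 + \<epsilon>) - \<epsilon> * (D U / (1 + \<epsilon>))"
          by (simp add: c_def algebra_simps)
        ultimately have "p * (1 + \<epsilon> - 1) * (real (card U))\<^sup>2 / 2 - D U * ln (1 + \<epsilon>) \<le> - 2 * card U * ln n"
          by linarith
        then show ?thesis by (simp only: exp_le_cancel_iff)
      qed
      finally show ?thesis .
    qed
    define Bad where "Bad = {E. \<exists>U\<subseteq>{..<n}. U \<noteq> {} \<and> card U \<le> z \<and> E \<in> bad U}"
    have Bad: "measure_pmf.prob (gnp n p) Bad \<le> exp (1 / n) - 1"
      unfolding Bad_def using prob by (intro prob_some_set_bad_le n0) auto
    define M where "M = K2 * ln n"
    obtain k :: nat where k: "\<And>(L::real) bad.
        (\<And>E S. E \<subseteq> all_pairs n \<Longrightarrow> E \<notin> bad \<Longrightarrow> S \<subseteq> {..<n} \<Longrightarrow> card S \<le> w * sqrt n \<Longrightarrow>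
          \<exists>j. colourable E S j \<and> real j \<le> L) \<Longrightarrow>
        1 - 8 / w\<^sup>2 - measure_pmf.prob (gnp n p) bad \<le> measure_pmf.prob (gnp n p)
          {E. k \<le> real (chromatic_number n E) \<and> real (chromatic_number n E) \<le> k + L}"
      using chromatic_number_window[OF n0 w, of p] by blast
    have "\<exists>j. colourable E S j \<and> real j \<le> C * (z * p / ln (z * p / ln n))"
      if E: "E \<subseteq> all_pairs n" "E \<notin> Bad" and S: "S \<subseteq> {..<n}" "card S \<le> w * sqrt n" for E S
    proof -
      have fin: "finite S" using S(1) finite_subset by blast
      have low: "\<exists>v\<in>U. card (nbrs E U v) < max ((1 + \<epsilon>) * p * card U) M"
        if U: "U \<subseteq> S" "U \<noteq> {}" for U
      proof -
        have finU: "finite U" using U(1) fin finite_subset by blast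
        then have u: "0 < real (card U)" using U(2) by (simp add: card_gt_0_iff)
        have "card U \<le> card S" using U(1) fin by (intro card_mono)
        then have "card U \<le> z" using S(2) z by simp
        moreover have "U \<subseteq> {..<n}" using U(1) S(1) by (rule subset_trans)
        ultimately have "E \<notin> bad U" using E(2) U(2) unfolding Bad_def by blast
        then have "card (induced_edges E U) < D U"
          by (simp add: bad_def)
        then obtain v where v: "v \<in> U" "card (nbrs E U v) < 2 * D U / card U"
          using exists_vertex_degree_less[OF E(1) finU U(2)] by blast
        have "2 * D U / card U \<le> max ((1 + \<epsilon>) * p * card U) M"
        proof -
          define m where "m = max ((1 + \<epsilon>) * p * card U) M"
          have "2 * K * ln n \<le> M" using K2(2) n by (simp add: M_def mult_right_mono)
          then have "(1 + \<epsilon>) * p * card U * card U \<le> m * card U" "2 * K * ln n * card U \<le> m * card U"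
            by (intro mult_right_mono; simp add: m_def)+
          then have "D U \<le> m * card U / 2"
            unfolding D_def by (intro max.boundedI) (simp_all add: power2_eq_square mult_ac)
          then show ?thesis using u by (simp add: m_def[symmetric] pos_divide_le_eq)
        qed
        then show ?thesis using v by force
      qed
      have R1: "1 < z * p / ln n" "K2\<^sup>2 \<le> z * p / ln n"
        using R R0 unfolding R0_def by linarith+
      have "1 \<le> \<epsilon> * K2" using K2(3) \<epsilon> by (simp add: field_simps)
      then have M1: "1 \<le> \<epsilon> * M"
        using n mult_mono[of 1 "\<epsilon> * K2" 1 "ln n"] by (simp add: M_def mult.assoc)
      have M2: "M < z * p"
      proof -
        have "K2 \<le> K2\<^sup>2" using K2(1) by (simp add: power2_eq_square)
        then have "K2 < z * p / ln n" using R by (simp add: R0_def)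
        then show ?thesis using n by (simp add: M_def pos_less_divide_eq)
      qed
      have q: "(1 + 2 * \<epsilon>) * p \<le> q1"
      proof -
        have "(1 + 2 * \<epsilon>) * p \<le> (1 + 2 * \<epsilon>) * \<gamma>" using p \<epsilon> by (intro mult_left_mono) auto
        also have "\<dots> \<le> \<gamma> + 2 * \<epsilon> * 1" using assms \<epsilon> by (simp add: algebra_simps mult_left_le)
        also have "\<dots> = q1" by (simp add: \<epsilon>_def q1_def field_simps)
        finally show ?thesis .
      qed
      have "z * (2 * ((1 + 2 * \<epsilon>) * p) / (1 - q1)) = z * p * b" by (simp add: b_def)
      then obtain j where j: "colourable E S j"
        "real j \<le> max ((1 + \<epsilon>) * sqrt (z * p * M)) M + 1 + z * p * b / ln (z * p / M)"
        using colourable_locally_sparse[OF fin _ p(1) \<epsilon>(1) M1 M2 refl q \<epsilon>(3) low] S(2) z by auto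
      have "max ((1 + \<epsilon>) * sqrt (z * p * M)) M + 1 + z * p * b / ln (z * p / M) \<le>
          C * (z * p / ln (z * p / ln n))"
        unfolding M_def C_def
        by (intro dense_palette_bound n K2 \<epsilon> R1) (use b n in auto)
      then show ?thesis using j by (intro exI[of _ j]) auto
    qed
    then have "1 - 8 / w\<^sup>2 - measure_pmf.prob (gnp n p) Bad \<le>
        measure_pmf.prob (gnp n p) (chi_window n k (C * (z * p / ln (z * p / ln n))))"
      unfolding chi_window_def by (rule k)
    then have "1 - 8 / w\<^sup>2 - (exp (1 / n) - 1) \<le>
        measure_pmf.prob (gnp n p) (chi_window n k (C * (z * p / ln (z * p / ln n))))"
      using Bad by linarith
    then show "\<exists>a. 1 - 8 / w\<^sup>2 - (exp (1 / n) - 1) \<le>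
        measure_pmf.prob (gnp n p) (chi_window n a (C * (z * p / ln (z * p / ln n))))" ..
  qed
qed

text \<open>If \<open>X \<ge> 1 / 3\<close>, the small sets are coloured by degeneracy with about
  \<open>12 * X\<close> colours, and rounding up fits into \<open>15 * X\<close>. If
  \<open>X < 1 / 3\<close>, the ratio \<open>R\<close> exceeds \<open>n ^ 3\<close>, so the graph
  has no edge outside probability \<open>2 / n\<close> and the chromatic number is 1.\<close>

lemma sparse_window:
  fixes n :: nat and w p z :: real
  assumes n: "1 \<le> ln (real n)" and w: "2 \<le> w" and p: "0 < p" "p \<le> 1"
    and z: "z = w * sqrt n" and R: "exp 1 \<le> ln n / (z * p)"
  shows "\<exists>a. 1 - 8 / w\<^sup>2 - (exp (1 / n) - 1) - 2 / n \<le>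
    measure_pmf.prob (gnp n p) (chi_window n a (15 * (ln n / ln (ln n / (z * p)))))"
proof -
  define R where "R = ln n / (z * p)"
  define X where "X = ln n / ln R"
  have n0: "0 < n" using n by (cases n) auto
  have zp: "0 < z" "0 < z * p" using z w n0 p by auto
  have "1 < exp (1::real)" by simp
  then have R1: "1 < R" using R unfolding R_def by linarith
  have lnR: "1 \<le> ln R" using R R1 by (subst ln_ge_iff) (auto simp: R_def)
  have X0: "0 < X" using n lnR by (simp add: X_def)
  have zpR: "z * p * R = ln n" using zp p by (simp add: R_def)
  show ?thesis
  proof (cases "1 / 3 \<le> X")
    case True
    \<comment> \<open>With base \<open>sqrt R\<close> the threshold contributes
      \<open>3 * card U * ln n\<close> to the Chernoff exponent. The mean term costs at most
      \<open>card U * ln n\<close>, because \<open>card U \<le> z\<close> and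
      \<open>z * p * R = ln n\<close>; this leaves the required factor 2.\<close>
    define bad where "bad U = {E. 6 * X * card U \<le> card (induced_edges E U)}" for U :: "nat set"
    have prob: "measure_pmf.prob (gnp n p) (bad U) \<le> exp (- 2 * card U * ln n)"
      if U: "U \<subseteq> {..<n}" "card U \<le> z" for U
    proof -
      have "measure_pmf.prob (gnp n p) (bad U) \<le>
          exp (p * (sqrt R - 1) * (real (card U))\<^sup>2 / 2 - 6 * X * card U * ln (sqrt R))"
        unfolding bad_def using prob_many_induced_edges_le[of p "sqrt R" U n "6 * X * card U"] p R1 U
        by simp
      also have "\<dots> \<le> exp (- 2 * card U * ln n)"
      proof -
        have "6 * X * card U * ln (sqrt R) = 3 * card U * ln n"
          using R1 lnR by (simp add: X_def ln_sqrt)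
        moreover have "p * (sqrt R - 1) * (real (card U))\<^sup>2 / 2 \<le> card U * ln n"
        proof -
          have "sqrt R \<le> R" using R1 real_le_lsqrt[of R R] by (simp add: power2_eq_square)
          then have "p * (sqrt R - 1) \<le> p * R" using p by (intro mult_left_mono) auto
          then have "p * (sqrt R - 1) * (card U * real (card U)) \<le> p * R * (card U * z)"
            using U(2) p R1 zp by (intro mult_mono) auto
          also have "\<dots> = card U * ln n" by (simp flip: zpR)
          finally have "p * (sqrt R - 1) * (real (card U))\<^sup>2 \<le> card U * ln n"
            by (simp add: power2_eq_square)
          moreover have "0 \<le> card U * ln n" using n by simp
          ultimately show ?thesis by simp
        qed
        ultimately have "p * (sqrt R - 1) * (real (card U))\<^sup>2 / 2 - 6 * X * card U * ln (sqrt R) \<le>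
            - 2 * card U * ln n"
          by linarith
        then show ?thesis by (simp only: exp_le_cancel_iff)
      qed
      finally show ?thesis .
    qed
    define Bad where "Bad = {E. \<exists>U\<subseteq>{..<n}. U \<noteq> {} \<and> card U \<le> z \<and> E \<in> bad U}"
    have Bad: "measure_pmf.prob (gnp n p) Bad \<le> exp (1 / n) - 1"
      unfolding Bad_def using prob by (intro prob_some_set_bad_le n0) auto
    obtain k :: nat where k: "\<And>(L::real) bad.
        (\<And>E S. E \<subseteq> all_pairs n \<Longrightarrow> E \<notin> bad \<Longrightarrow> S \<subseteq> {..<n} \<Longrightarrow> card S \<le> w * sqrt n \<Longrightarrow>
          \<exists>j. colourable E S j \<and> real j \<le> L) \<Longrightarrow>
        1 - 8 / w\<^sup>2 - measure_pmf.prob (gnp n p) bad \<le> measure_pmf.prob (gnp n p)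
          {E. k \<le> real (chromatic_number n E) \<and> real (chromatic_number n E) \<le> k + L}"
      using chromatic_number_window[OF n0 w, of p] by blast
    have "\<exists>j. colourable E S j \<and> real j \<le> 15 * X"
      if E: "E \<subseteq> all_pairs n" "E \<notin> Bad" and S: "S \<subseteq> {..<n}" "card S \<le> w * sqrt n" for E S
    proof -
      have fin: "finite S" using S(1) finite_subset by blast
      have "colourable E S (nat \<lceil>12 * X\<rceil>)"
      proof (rule colourable_nat_ceiling[OF fin])
        fix U assume U: "U \<subseteq> S" "U \<noteq> {}"
        have finU: "finite U" using U(1) fin finite_subset by blast
        then have u: "0 < real (card U)" using U(2) by (simp add: card_gt_0_iff)
        have "card U \<le> card S" using U(1) fin by (intro card_mono)
        then have "card U \<le> z" using S(2) z by simp
        moreover have "U \<subseteq> {..<n}" using U(1) S(1) by (rule subset_trans)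
        ultimately have "E \<notin> bad U" using E(2) U(2) unfolding Bad_def by blast
        then have "card (induced_edges E U) < 6 * X * card U"
          by (simp add: bad_def)
        from exists_vertex_degree_less[OF E(1) finU U(2) this]
        show "\<exists>v\<in>U. card (nbrs E U v) < 12 * X" using u by simp
      qed
      moreover have "nat \<lceil>12 * X\<rceil> \<le> 15 * X" using True X0 by linarith
      ultimately show ?thesis by blast
    qed
    then have "1 - 8 / w\<^sup>2 - measure_pmf.prob (gnp n p) Bad \<le>
        measure_pmf.prob (gnp n p) (chi_window n k (15 * X))"
      unfolding chi_window_def by (rule k)
    moreover have "0 \<le> 2 / real n" by simp
    ultimately have "1 - 8 / w\<^sup>2 - (exp (1 / n) - 1) - 2 / n \<le>
        measure_pmf.prob (gnp n p) (chi_window n k (15 * X))"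
      using Bad by linarith
    then show ?thesis unfolding X_def R_def ..
  next
    case False
    then have "3 * ln n < ln R" using lnR by (simp add: X_def field_simps)
    then have "exp (3 * ln n) < exp (ln R)" by simp
    then have nR: "real n ^ 3 < R"
      using n0 R1 exp_of_nat_mult[of 3 "ln (real n)"] by simp
    have "z * p * real n ^ 3 \<le> ln n"
      using nR zp mult_left_mono[of "real n ^ 3" R "z * p"] by (simp add: zpR)
    also have "\<dots> \<le> 2 * sqrt n" using n0 by (intro ln_le_two_sqrt) auto
    also have "\<dots> \<le> z" using w by (simp add: z mult_right_mono)
    finally have pn: "p * real n ^ 3 \<le> 1" using zp by (simp add: mult.assoc)
    \<comment> \<open>The Chernoff bound with base \<open>n\<close> and threshold 1 on the whole
      vertex set bounds the probability of having any edge.\<close>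
    have "measure_pmf.prob (gnp n p) {E. 1 \<le> real (card (induced_edges E {..<n}))} \<le>
        exp (p * (real n - 1) * (real n)\<^sup>2 / 2 - 1 * ln n)"
      using prob_many_induced_edges_le[of p "real n" "{..<n}" n 1] p n0 by simp
    also have "\<dots> \<le> exp (1 / 2 - ln n)"
    proof -
      have "p * (real n - 1) * (real n)\<^sup>2 \<le> p * real n * (real n)\<^sup>2"
        using p by (intro mult_right_mono) auto
      also have "\<dots> \<le> 1" using pn by (simp add: power3_eq_cube power2_eq_square mult_ac)
      finally show ?thesis by simp
    qed
    also have "\<dots> = exp (1 / 2) / n" using n0 by (simp add: exp_diff)
    also have "\<dots> \<le> 2 / n"
    proof -
      have "(exp (1 / 2))\<^sup>2 = exp (1::real)" by (simp flip: exp_double)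
      also have "\<dots> \<le> 2\<^sup>2" using exp_le by simp
      finally have "exp (1 / 2) \<le> (2::real)" by (rule power2_le_imp_le) simp
      then show ?thesis by (simp add: divide_right_mono)
    qed
    finally have edge: "measure_pmf.prob (gnp n p) {E. 1 \<le> real (card (induced_edges E {..<n}))} \<le> 2 / n" .
    have "1 = measure_pmf.prob (gnp n p) UNIV" by simp
    also have "\<dots> \<le> measure_pmf.prob (gnp n p)
        (chi_window n 1 (15 * X) \<union> {E. 1 \<le> real (card (induced_edges E {..<n}))})"
    proof (rule measure_pmf.finite_measure_mono_AE)
      have one: "chromatic_number n E = 1" if "E \<subseteq> all_pairs n" "card (induced_edges E {..<n}) = 0" for E
      proof -
        have "induced_edges E {..<n} = E" using that(1) by (auto simp: induced_edges_def all_pairs_eq)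
        moreover have "finite E" using that(1) finite_all_pairs finite_subset by blast
        ultimately have "E = {}" using that(2) by simp
        then have "colourable E {..<n} 1" by (simp add: colourable_1_iff del: One_nat_def)
        moreover have "\<not> colourable E {..<n} 0" using n0 by (auto simp: colourable_def)
        ultimately show ?thesis
          using chromatic_number_le_iff[OF that(1), of 1] chromatic_number_le_iff[OF that(1), of 0] by linarith
      qed
      show "AE E in gnp n p. E \<in> UNIV \<longrightarrow>
          E \<in> chi_window n 1 (15 * X) \<union> {E. 1 \<le> real (card (induced_edges E {..<n}))}"
      proof (intro AE_pmfI impI)
        fix E assume "E \<in> set_pmf (gnp n p)"
        then have "chromatic_number n E = 1 \<or> 1 \<le> card (induced_edges E {..<n})"
          using one[OF set_pmf_gnp_subset, of E p] by (cases "card (induced_edges E {..<n})") auto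
        then show "E \<in> chi_window n 1 (15 * X) \<union> {E. 1 \<le> real (card (induced_edges E {..<n}))}"
          using X0 by (auto simp: chi_window_def)
      qed
    qed simp
    also have "\<dots> \<le> measure_pmf.prob (gnp n p) (chi_window n 1 (15 * X)) + 2 / n"
      using edge by (intro order.trans[OF measure_Un_le]) auto
    finally have "1 - 2 / n \<le> measure_pmf.prob (gnp n p) (chi_window n 1 (15 * X))" by simp
    moreover have "0 \<le> 8 / w\<^sup>2" "0 \<le> exp (1 / real n) - 1" by auto
    ultimately show ?thesis
      unfolding X_def R_def by (intro exI[of _ 1]) linarith
  qed
qed

section \<open>Passage to the limit\<close>

lemma choose_centres:
  fixes P :: "nat \<Rightarrow> real \<Rightarrow> real" and \<delta> :: "nat \<Rightarrow> real"
  assumes "\<forall>\<^sub>F n in sequentially. \<exists>a. 1 - \<delta> n \<le> P n a" "\<And>n a. P n a \<le> 1" "\<delta> \<longlonglongrightarrow> 0"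
  shows "\<exists>a. (\<lambda>n. P n (a n)) \<longlonglongrightarrow> 1"
proof -
  define a where "a n = (SOME a. 1 - \<delta> n \<le> P n a)" for n
  have low: "\<forall>\<^sub>F n in sequentially. 1 - \<delta> n \<le> P n (a n)"
    using assms(1) by eventually_elim (unfold a_def, rule someI_ex)
  have lim: "(\<lambda>n. 1 - \<delta> n) \<longlonglongrightarrow> 1"
    using tendsto_diff[OF tendsto_const assms(3), of 1] by simp
  have "(\<lambda>n. P n (a n)) \<longlonglongrightarrow> 1"
    by (rule tendsto_sandwich[OF low _ lim tendsto_const]) (simp add: assms(2))
  then show ?thesis by (rule exI[of _ a])
qed

lemma eventually_ge_of_inverse_tendsto_0:
  fixes f :: "nat \<Rightarrow> real"
  assumes "f \<longlonglongrightarrow> 0" "\<forall>\<^sub>F n in sequentially. 0 < f n" "0 < c"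
  shows "\<forall>\<^sub>F n in sequentially. c \<le> 1 / f n"
proof -
  have "\<forall>\<^sub>F n in sequentially. f n < 1 / c"
    using assms(1,3) by (intro order_tendstoD(2)) auto
  then show ?thesis
    using assms(2) by eventually_elim (use assms(3) in \<open>simp add: field_simps\<close>)
qed

theorem theorem3:
  fixes \<gamma> :: real
  assumes "0 < \<gamma>" and "\<gamma> < 1"
  shows "\<exists>C>0. \<forall>(\<omega>::nat \<Rightarrow> real) (p::nat \<Rightarrow> real).
     filterlim \<omega> at_top sequentially \<and> (\<forall>n. 0 < p n \<and> p n \<le> \<gamma>) \<longrightarrow>
     (let z = (\<lambda>n. \<omega> n * sqrt (real n)) in
       ((\<lambda>n. ln (real n) / (z n * p n)) \<longlonglongrightarrow> 0 \<longrightarrow>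
          (\<exists>a::nat \<Rightarrow> real.
             (\<lambda>n. measure_pmf.prob (gnp n (p n))
                {E. a n \<le> real (chromatic_number n E) \<and>
                    real (chromatic_number n E) \<le> a n + C * z n * p n / ln (z n * p n / ln (real n))})
             \<longlonglongrightarrow> 1)) \<and>
       ((\<lambda>n. z n * p n / ln (real n)) \<longlonglongrightarrow> 0 \<longrightarrow>
          (\<exists>a::nat \<Rightarrow> real.
             (\<lambda>n. measure_pmf.prob (gnp n (p n))
                {E. a n \<le> real (chromatic_number n E) \<and>
                    real (chromatic_number n E) \<le> a n + C * ln (real n) / ln (ln (real n) / (z n * p n))})
             \<longlonglongrightarrow> 1)))"
proof -
  obtain C1 R0 :: real where C1: "0 < C1" "1 < R0"
    and dense: "\<And>n w p z. 1 \<le> ln (real n) \<Longrightarrow> 2 \<le> w \<Longrightarrow> 0 < p \<Longrightarrow> p \<le> \<gamma> \<Longrightarrow> z = w * sqrt n \<Longrightarrow>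
           R0 \<le> z * p / ln n \<Longrightarrow>
           \<exists>a. 1 - 8 / w\<^sup>2 - (exp (1 / n) - 1) \<le>
             measure_pmf.prob (gnp n p) (chi_window n a (C1 * (z * p / ln (z * p / ln n))))"
    using dense_window[OF assms] by blast
  \<comment> \<open>One constant serves both regimes: enlarging it only widens a window, as long as
    the factor it multiplies is nonnegative.\<close>
  define C where "C = max C1 15"
  have widen: "measure_pmf.prob (gnp n q) (chi_window n a (c * X)) \<le>
      measure_pmf.prob (gnp n q) (chi_window n a (C * X))"
    if "c \<le> C" "0 \<le> X" for n q a c X
    using that mult_right_mono[of c C X]
    by (intro measure_pmf.finite_measure_mono) (auto simp: chi_window_def)
  show ?thesis
    unfolding Let_def
  proof (intro exI[of _ C] conjI allI impI)
    show "0 < C" using C1 by (simp add: C_def)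
    fix \<omega> p :: "nat \<Rightarrow> real"
    assume A: "filterlim \<omega> at_top sequentially \<and> (\<forall>n. 0 < p n \<and> p n \<le> \<gamma>)"
    define z where "z n = \<omega> n * sqrt (real n)" for n
    \<comment> \<open>A single null sequence that dominates the failure probabilities of both
      regimes.\<close>
    define \<delta> where "\<delta> n = 8 / (\<omega> n)\<^sup>2 + (exp (1 / real n) - 1) + 2 / real n" for n
    have p: "0 < p n" "p n \<le> \<gamma>" "p n \<le> 1" for n using A assms(2) by (auto intro: order.trans)
    have ev_w: "\<forall>\<^sub>F n in sequentially. 2 \<le> \<omega> n"
      using A by (simp add: filterlim_at_top)
    have ev_n: "\<forall>\<^sub>F n in sequentially. 1 \<le> ln (real n)"
      using filterlim_compose[OF ln_at_top filterlim_real_sequentially] by (simp add: filterlim_at_top)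
    have ev_pos: "\<forall>\<^sub>F n in sequentially. 0 < z n * p n"
      using ev_w ev_n
    proof eventually_elim
      case (elim n)
      then have "n \<noteq> 0" by (cases n) auto
      then show ?case using elim p by (auto simp: z_def)
    qed
    have \<delta>: "\<delta> \<longlonglongrightarrow> 0"
    proof -
      have "filterlim (\<lambda>n. (\<omega> n)\<^sup>2) at_top sequentially"
        using A by (intro filterlim_pow_at_top) auto
      then have "(\<lambda>n. 8 / (\<omega> n)\<^sup>2) \<longlonglongrightarrow> 0"
        by (intro tendsto_divide_0[OF tendsto_const] filterlim_at_top_imp_at_infinity)
      moreover have "(\<lambda>n. exp (1 / real n)) \<longlonglongrightarrow> exp 0"
        by (intro tendsto_exp lim_1_over_n)
      then have "(\<lambda>n. exp (1 / real n) - 1) \<longlonglongrightarrow> 0"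
        using tendsto_diff[OF _ tendsto_const, of _ _ _ 1] by fastforce
      moreover have "(\<lambda>n. 2 / real n) \<longlonglongrightarrow> 0" by (rule lim_const_over_n)
      ultimately show ?thesis
        unfolding \<delta>_def by (intro tendsto_add_zero)
    qed
    {
      assume "(\<lambda>n. ln (real n) / (\<omega> n * sqrt (real n) * p n)) \<longlonglongrightarrow> 0"
      then have lim: "(\<lambda>n. ln (real n) / (z n * p n)) \<longlonglongrightarrow> 0" by (simp add: z_def)
      have "\<forall>\<^sub>F n in sequentially. 0 < ln (real n) / (z n * p n)"
        using ev_n ev_pos by eventually_elim simp
      then have "\<forall>\<^sub>F n in sequentially. R0 \<le> 1 / (ln (real n) / (z n * p n))"
        using lim C1(2) by (intro eventually_ge_of_inverse_tendsto_0) auto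
      then have "\<forall>\<^sub>F n in sequentially. \<exists>a. 1 - \<delta> n \<le>
          measure_pmf.prob (gnp n (p n)) (chi_window n a (C * (z n * p n / ln (z n * p n / ln n))))"
        using ev_w ev_n ev_pos
      proof eventually_elim
        case (elim n)
        then have R: "R0 \<le> z n * p n / ln n" by simp
        obtain a where a: "1 - 8 / (\<omega> n)\<^sup>2 - (exp (1 / n) - 1) \<le>
            measure_pmf.prob (gnp n (p n)) (chi_window n a (C1 * (z n * p n / ln (z n * p n / ln n))))"
          using dense[OF elim(3,2) p(1,2) z_def R] by blast
        also have "\<dots> \<le> measure_pmf.prob (gnp n (p n)) (chi_window n a (C * (z n * p n / ln (z n * p n / ln n))))"
          using R C1 elim(4) by (intro widen) (auto simp: C_def)
        finally have "1 - \<delta> n \<le> \<dots>" unfolding \<delta>_def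
          by (smt (verit) divide_nonneg_nonneg of_nat_0_le_iff)
        then show ?case by blast
      qed
      from choose_centres[OF this measure_pmf.prob_le_1 \<delta>]
      show "\<exists>a. (\<lambda>n. measure_pmf.prob (gnp n (p n))
          {E. a n \<le> real (chromatic_number n E) \<and> real (chromatic_number n E) \<le>
            a n + C * (\<omega> n * sqrt (real n)) * p n / ln (\<omega> n * sqrt (real n) * p n / ln (real n))}) \<longlonglongrightarrow> 1"
        by (simp add: chi_window_def z_def mult.assoc)
    next
      assume "(\<lambda>n. \<omega> n * sqrt (real n) * p n / ln (real n)) \<longlonglongrightarrow> 0"
      then have lim: "(\<lambda>n. z n * p n / ln (real n)) \<longlonglongrightarrow> 0" by (simp add: z_def)
      have "\<forall>\<^sub>F n in sequentially. 0 < z n * p n / ln (real n)"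
        using ev_n ev_pos by eventually_elim simp
      then have "\<forall>\<^sub>F n in sequentially. exp 1 \<le> 1 / (z n * p n / ln (real n))"
        using lim by (intro eventually_ge_of_inverse_tendsto_0) auto
      then have "\<forall>\<^sub>F n in sequentially. \<exists>a. 1 - \<delta> n \<le>
          measure_pmf.prob (gnp n (p n)) (chi_window n a (C * (ln n / ln (ln n / (z n * p n)))))"
        using ev_w ev_n
      proof eventually_elim
        case (elim n)
        then have R: "exp 1 \<le> ln n / (z n * p n)" by simp
        have "1 < exp (1::real)" by simp
        then have "0 < ln (ln n / (z n * p n))" using R by (intro ln_gt_zero) linarith
        obtain a where a: "1 - 8 / (\<omega> n)\<^sup>2 - (exp (1 / n) - 1) - 2 / n \<le>
            measure_pmf.prob (gnp n (p n)) (chi_window n a (15 * (ln n / ln (ln n / (z n * p n)))))"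
          using sparse_window[OF elim(3,2) p(1,3) z_def R] by blast
        also have "\<dots> \<le> measure_pmf.prob (gnp n (p n)) (chi_window n a (C * (ln n / ln (ln n / (z n * p n)))))"
          using elim(3) \<open>0 < ln (ln n / (z n * p n))\<close> by (intro widen) (auto simp: C_def)
        finally show ?case unfolding \<delta>_def by (intro exI[of _ a]) linarith
      qed
      from choose_centres[OF this measure_pmf.prob_le_1 \<delta>]
      show "\<exists>a. (\<lambda>n. measure_pmf.prob (gnp n (p n))
          {E. a n \<le> real (chromatic_number n E) \<and> real (chromatic_number n E) \<le>
            a n + C * ln (real n) / ln (ln (real n) / (\<omega> n * sqrt (real n) * p n))}) \<longlonglongrightarrow> 1"
        by (simp add: chi_window_def z_def mult.assoc)
    }
  qed
qed

end
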